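(* Let $g(h)=\sup_{P\in\mathcal C(h)}\varrho(P)$. There exist absolute constants $c_1,c_2>0$ such that for every integer $h\geq 1$, \[ c_1\, h^{1/3}\;\le\; g(h)\;\le\; c_2\, h^{1/2}. \]
   Context: For $h\in\mathbb N$, $\mathcal C(h)$ denotes the family of polygonal domains $P=P_0\setminus\bigcup_{i=1}^h \operatorname{int}(P_i)$, where $P_0$ is a convex polygon in the plane and $P_1,\dots,P_h$ (the holes) are pairwise disjoint convex polygons contained in the interior of $P_0$. For $s,t\in P$, $|st|$ is the Euclidean distance and ${\rm geod}(s,t)$ is the infimum of the Euclidean lengths of polygonal paths from $s$ to $t$ contained in $P$. The Euclidean diameter is ${\rm diam}_2(P)=\sup_{s,t\in P}|st|$, the geodesic diameter is ${\rm diam}_g(P)=\sup_{s,t\in P}{\rm geod}(s,t)$, and the distortion is $\varrho(P)={\rm diam}_g(P)/{\rm diam}_2(P)$. *)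

theory Defs
  imports "HOL-Analysis.Analysis"
begin

type_synonym pt = "real^2"

definition convex_polygon :: "pt set \<Rightarrow> bool" where
  "convex_polygon K \<longleftrightarrow> polytope K \<and> interior K \<noteq> {}"

definition domains :: "nat \<Rightarrow> pt set set" where
  "domains h = {P. \<exists>P0 (H :: nat \<Rightarrow> pt set).
      convex_polygon P0 \<and>
      (\<forall>i\<in>{1..h}. convex_polygon (H i) \<and> H i \<subseteq> interior P0) \<and>
      (\<forall>i\<in>{1..h}. \<forall>j\<in>{1..h}. i \<noteq> j \<longrightarrow> H i \<inter> H j = {}) \<and>
      P = P0 - (\<Union>i\<in>{1..h}. interior (H i))}"

definition polygonal_path_in :: "pt set \<Rightarrow> pt \<Rightarrow> pt \<Rightarrow> pt list \<Rightarrow> bool" where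
  "polygonal_path_in P s t ps \<longleftrightarrow> ps \<noteq> [] \<and> hd ps = s \<and> last ps = t \<and>
     (\<forall>i < length ps - 1. closed_segment (ps ! i) (ps ! Suc i) \<subseteq> P)"

definition path_len :: "pt list \<Rightarrow> real" where
  "path_len ps = (\<Sum>i < length ps - 1. dist (ps ! i) (ps ! Suc i))"

definition geod :: "pt set \<Rightarrow> pt \<Rightarrow> pt \<Rightarrow> real" where
  "geod P s t = Inf (path_len ` {ps. polygonal_path_in P s t ps})"

definition diam2 :: "pt set \<Rightarrow> ereal" where
  "diam2 P = (SUP s\<in>P. SUP t\<in>P. ereal (dist s t))"

definition diamg :: "pt set \<Rightarrow> ereal" where
  "diamg P = (SUP s\<in>P. SUP t\<in>P. ereal (geod P s t))"

definition distortion :: "pt set \<Rightarrow> ereal" where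
  "distortion P = diamg P / diam2 P"

definition g :: "nat \<Rightarrow> ereal" where
  "g h = (SUP P\<in>domains h. distortion P)"

end

theory Submission
  imports Defs
begin

text \<open>
  Upper bound. Fix \<open>c\<close> and measure progress by \<open>\<xi> = x - c y\<close>. Starting at a point of the domain, walk
  horizontally to the right; on hitting a hole, slide along its left boundary, away from the point
  \<open>L\<^sub>c\<close> of the hole minimizing \<open>\<xi>\<close>, up to its top or down to its bottom, and continue. Then \<open>\<xi>\<close> never
  decreases, every hole is slid along at most once in each direction, and a slide of height \<open>t\<close> gains
  at least \<open>t / N\<close> in \<open>\<xi>\<close>, except for the part of the boundary between the minimizers \<open>L\<^sub>c\<close> and
  \<open>L\<close> for \<open>c + 1 / N\<close> or \<open>c - 1 / N\<close>. For the slopes \<open>c = k / N\<close> these exceptional parts of one hole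
  telescope to \<open>O(d)\<close>, where \<open>d\<close> is the diameter, so some \<open>k\<close> has total exceptional height \<open>O(h d / N)\<close>. The walk has length
  \<open>O(N d + h d / N)\<close>; take \<open>N\<close> about \<open>\<surd>h\<close>. It ends on the right boundary of the outer polygon, along
  which any two endpoints are joined.

  Lower bound. Surround the origin by about \<open>k\<^sup>2\<close> concentric regular \<open>k\<close>-gons with inradii between
  1 and 2, consecutive ones rotated by \<open>\<pi> / k\<close>; the holes are thin neighbourhoods of the edges
  shortened a little at both ends. A path to the outside must leave every \<open>k\<close>-gon near a vertex, and
  vertices of consecutive \<open>k\<close>-gons are at distance of order \<open>1 / k\<close>, which adds up to a length of order \<open>k\<close>
  with about \<open>k\<^sup>3\<close> holes.
\<close>

section \<open>Polygonal paths\<close>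

text \<open>The existence of a path is bundled with its length bound: \<open>geod\<close> is a real
  infimum, which carries no information when there is no path at all.\<close>

definition reach :: "pt set \<Rightarrow> pt \<Rightarrow> pt \<Rightarrow> real \<Rightarrow> bool" where
  "reach P s t l \<longleftrightarrow> (\<exists>ps. polygonal_path_in P s t ps \<and> path_len ps \<le> l)"

lemma path_len_Cons_Cons:
  "path_len (x # y # ps) = dist x y + path_len (y # ps)"
  by (simp add: path_len_def sum.lessThan_Suc_shift del: sum.lessThan_Suc)

lemma polygonal_path_in_single: "polygonal_path_in P s t [x] \<longleftrightarrow> x = s \<and> x = t"
  by (auto simp: polygonal_path_in_def)

lemma polygonal_path_in_Cons_Cons:
  "polygonal_path_in P s t (x # y # ps) \<longleftrightarrow>
     x = s \<and> closed_segment x y \<subseteq> P \<and> polygonal_path_in P y t (y # ps)"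
  by (auto simp: polygonal_path_in_def All_less_Suc2)

lemma path_len_nonneg: "path_len ps \<ge> 0"
  by (simp add: path_len_def sum_nonneg)

lemma dist_le_path_len: "polygonal_path_in P s t ps \<Longrightarrow> dist s t \<le> path_len ps"
proof (induction ps arbitrary: s rule: induct_list012)
  case 1
  then show ?case by (simp add: polygonal_path_in_def)
next
  case (2 x)
  then show ?case by (auto simp: polygonal_path_in_single path_len_def)
next
  case (3 x y zs)
  then have "dist y t \<le> path_len (y # zs)" and "x = s"
    by (auto simp: polygonal_path_in_Cons_Cons)
  then show ?case using dist_triangle[of s t y] by (simp add: path_len_Cons_Cons)
qed

lemma reach_mono: "reach P s t l \<Longrightarrow> l \<le> l' \<Longrightarrow> reach P s t l'"
  by (force simp: reach_def)

lemma reach_refl: "0 \<le> l \<Longrightarrow> reach P s s l"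
  unfolding reach_def by (rule exI[of _ "[s]"]) (auto simp: polygonal_path_in_single path_len_def)

lemma reach_Cons:
  assumes "closed_segment x y \<subseteq> P" "reach P y u c"
  shows "reach P x u (dist x y + c)"
proof -
  obtain ps where ps: "polygonal_path_in P y u ps" "path_len ps \<le> c"
    using assms(2) by (auto simp: reach_def)
  then obtain qs where "ps = y # qs"
    by (cases ps) (auto simp: polygonal_path_in_def)
  then show ?thesis unfolding reach_def using ps assms(1)
    by (intro exI[of _ "x # ps"]) (auto simp: polygonal_path_in_Cons_Cons path_len_Cons_Cons)
qed

lemma reach_segment: "closed_segment s t \<subseteq> P \<Longrightarrow> reach P s t (dist s t)"
  using reach_Cons[OF _ reach_refl[of 0]] by auto

lemma reach_trans_path:
  "polygonal_path_in P s t ps \<Longrightarrow> reach P t u b \<Longrightarrow> reach P s u (path_len ps + b)"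
proof (induction ps arbitrary: s rule: induct_list012)
  case 1
  then show ?case by (simp add: polygonal_path_in_def)
next
  case (2 x)
  then show ?case by (auto simp: polygonal_path_in_single path_len_def)
next
  case (3 x y zs)
  then have "closed_segment s y \<subseteq> P" "reach P y u (path_len (y # zs) + b)" "x = s"
    by (auto simp: polygonal_path_in_Cons_Cons)
  from reach_Cons[OF this(1,2)] this(3) show ?case by (simp add: path_len_Cons_Cons add.assoc)
qed

lemma reach_trans: "reach P s t a \<Longrightarrow> reach P t u b \<Longrightarrow> reach P s u (a + b)"
  by (auto simp: reach_def[of P s t] intro: reach_mono[OF reach_trans_path])

lemma reach_sym_path: "polygonal_path_in P s t ps \<Longrightarrow> reach P t s (path_len ps)"
proof (induction ps arbitrary: s rule: induct_list012)
  case 1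
  then show ?case by (simp add: polygonal_path_in_def)
next
  case (2 x)
  then show ?case by (auto simp: polygonal_path_in_single path_len_def intro: reach_refl)
next
  case (3 x y zs)
  then have "closed_segment y s \<subseteq> P" "reach P t y (path_len (y # zs))" "x = s"
    by (auto simp: polygonal_path_in_Cons_Cons closed_segment_commute)
  from reach_trans[OF this(2) reach_segment[OF this(1)]] this(3)
  show ?case by (simp add: path_len_Cons_Cons add.commute dist_commute)
qed

lemma reach_sym: "reach P s t l \<Longrightarrow> reach P t s l"
  by (auto simp: reach_def[of P s t] intro: reach_mono[OF reach_sym_path])

lemma geod_le: "reach P s t l \<Longrightarrow> geod P s t \<le> l"
  unfolding reach_def geod_def
  by (auto intro!: cInf_lower2 bdd_belowI[of _ 0] simp: path_len_nonneg)

lemma geod_ge: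
  assumes "reach P s t l" "\<And>ps. polygonal_path_in P s t ps \<Longrightarrow> b \<le> path_len ps"
  shows "b \<le> geod P s t"
  unfolding geod_def using assms by (intro cInf_greatest) (auto simp: reach_def)

section \<open>Replacing curves by polygonal paths\<close>

definition locally_star :: "pt set \<Rightarrow> bool" where
  "locally_star P \<longleftrightarrow> (\<forall>x\<in>P. \<forall>\<^sub>F y in nhds x. y \<in> P \<longrightarrow> closed_segment x y \<subseteq> P)"

text \<open>By local star-shapedness, short chords ending at \<open>\<gamma> x\<close> stay in
  \<open>P\<close>, and bisection of the parameter interval chains finitely many of them. The
  increments of \<open>m\<close> dominate the chords and play the role of arc length.\<close>

lemma reach_curve:
  fixes \<gamma> :: "real \<Rightarrow> pt"
  assumes star: "locally_star P" and "a \<le> b" and cont: "continuous_on {a..b} \<gamma>"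
    and sub: "\<gamma> ` {a..b} \<subseteq> P"
    and len: "\<And>u v. a \<le> u \<Longrightarrow> u \<le> v \<Longrightarrow> v \<le> b \<Longrightarrow> dist (\<gamma> u) (\<gamma> v) \<le> m v - m u"
  shows "reach P (\<gamma> a) (\<gamma> b) (m b - m a)"
proof -
  define Q where "Q u v \<longleftrightarrow> a \<le> u \<and> v \<le> b \<longrightarrow> reach P (\<gamma> u) (\<gamma> v) (m v - m u)" for u v
  have "Q a b"
    using \<open>a \<le> b\<close>
  proof (induction rule: Bolzano)
    case (trans u v w)
    then show ?case using reach_trans[of P "\<gamma> u" "\<gamma> v" "m v - m u" "\<gamma> w" "m w - m v"] by (auto simp: Q_def)
  next
    case (local x)
    then have "\<gamma> x \<in> P" using sub by auto
    with star have "\<forall>\<^sub>F y in nhds (\<gamma> x). y \<in> P \<longrightarrow> closed_segment (\<gamma> x) y \<subseteq> P"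
      by (auto simp: locally_star_def)
    then obtain e where e: "e > 0"
      "\<And>y. dist y (\<gamma> x) < e \<Longrightarrow> y \<in> P \<Longrightarrow> closed_segment (\<gamma> x) y \<subseteq> P"
      unfolding eventually_nhds_metric by blast
    obtain d where d: "d > 0" "\<And>y. y \<in> {a..b} \<Longrightarrow> dist y x < d \<Longrightarrow> dist (\<gamma> y) (\<gamma> x) < e"
      using cont local \<open>e > 0\<close> unfolding continuous_on_iff by (metis atLeastAtMost_iff)
    have seg: "closed_segment (\<gamma> x) (\<gamma> y) \<subseteq> P" if "y \<in> {a..b}" "dist y x < d" for y
      using e(2) d(2) that sub by blast
    show ?case
      unfolding Q_def
    proof (intro exI[of _ d] conjI allI impI)
      fix u v assume uv: "u \<le> x \<and> x \<le> v \<and> v - u < d" "a \<le> u \<and> v \<le> b"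
      have "reach P (\<gamma> u) (\<gamma> x) (dist (\<gamma> u) (\<gamma> x))"
        using uv local seg[of u] by (intro reach_segment) (auto simp: dist_real_def closed_segment_commute)
      moreover have "reach P (\<gamma> x) (\<gamma> v) (dist (\<gamma> x) (\<gamma> v))"
        using uv local seg[of v] by (intro reach_segment) (auto simp: dist_real_def)
      ultimately have "reach P (\<gamma> u) (\<gamma> v) (dist (\<gamma> u) (\<gamma> x) + dist (\<gamma> x) (\<gamma> v))"
        by (rule reach_trans)
      then show "reach P (\<gamma> u) (\<gamma> v) (m v - m u)"
        using len[of u x] len[of x v] uv local by (elim reach_mono) auto
    qed (use d in auto)
  qed
  then show ?thesis by (simp add: Q_def)
qed

section \<open>Local structure of polygonal domains\<close>

lemma polytope_halfspaces:
  fixes K :: "'a::euclidean_space set"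
  assumes "polytope K"
  obtains F where "finite F" "K = \<Inter>F" "\<And>h. h \<in> F \<Longrightarrow> \<exists>a b. a \<noteq> 0 \<and> h = {x. a \<bullet> x \<le> b}"
  using polytope_imp_polyhedron[OF assms] unfolding polyhedron_def by metis

text \<open>On a segment from a boundary point \<open>x\<close>, the value
  \<open>a \<bullet> z - b\<close> is a nonnegative multiple of its value at \<open>y\<close>. If
  \<open>x\<close> lies in the open half-space, so do all nearby \<open>y\<close>.\<close>

lemma halfspace_local:
  fixes a x :: "'a::euclidean_space"
  assumes "a \<bullet> x \<le> b"
  shows "\<forall>\<^sub>F y in nhds x. \<forall>z\<in>closed_segment x y. a \<bullet> z < b \<longrightarrow> a \<bullet> y < b"
proof (cases "a \<bullet> x = b")
  case True
  have "a \<bullet> y < b" if "z \<in> closed_segment x y" "a \<bullet> z < b" for y z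
  proof -
    from that obtain u where u: "0 \<le> u" "u \<le> 1" "z = (1 - u) *\<^sub>R x + u *\<^sub>R y"
      by (auto simp: in_segment)
    then have "u * (a \<bullet> y - b) < 0"
      using that(2) True unfolding u(3) by (simp add: inner_simps algebra_simps)
    then show ?thesis using u by (simp add: mult_less_0_iff)
  qed
  then show ?thesis by (auto intro: always_eventually)
next
  case False
  then have "\<forall>\<^sub>F y in nhds x. y \<in> {y. a \<bullet> y < b}"
    using assms by (intro eventually_nhds_in_open open_halfspace_lt) auto
  then show ?thesis by (rule eventually_mono) auto
qed

text \<open>For \<open>x\<close> in \<open>K\<close>, a segment point in the interior satisfies all
  strict inequalities, and \<open>halfspace_local\<close> passes them on to \<open>y\<close>. For
  \<open>x\<close> outside \<open>K\<close>, a whole ball around \<open>x\<close> misses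
  \<open>K\<close>.\<close>

lemma polytope_complement_local:
  fixes x :: "'a::euclidean_space"
  assumes "polytope K"
  shows "\<forall>\<^sub>F y in nhds x. y \<notin> interior K \<longrightarrow> closed_segment x y \<inter> interior K = {}"
proof (cases "x \<in> K")
  case True
  obtain F where F: "finite F" "K = \<Inter>F" "\<And>h. h \<in> F \<Longrightarrow> \<exists>a b. a \<noteq> 0 \<and> h = {x. a \<bullet> x \<le> b}"
    using polytope_halfspaces[OF assms] by blast
  have int: "interior K = (\<Inter>h\<in>F. interior h)"
    unfolding F(2) using F(1) by (induction F rule: finite_induct) auto
  have "\<forall>\<^sub>F y in nhds x. \<forall>h\<in>F. \<forall>z\<in>closed_segment x y. z \<in> interior h \<longrightarrow> y \<in> interior h"
  proof (rule eventually_ball_finite[OF F(1)], rule ballI)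
    fix h assume "h \<in> F"
    then obtain a b where "a \<noteq> 0" "h = {x. a \<bullet> x \<le> b}" using F(3) by blast
    then show "\<forall>\<^sub>F y in nhds x. \<forall>z\<in>closed_segment x y. z \<in> interior h \<longrightarrow> y \<in> interior h"
      using halfspace_local[of a x b] True \<open>h \<in> F\<close> F(2) by auto
  qed
  then show ?thesis by (rule eventually_mono) (use int in auto)
next
  case False
  have "open (- K)" using assms polytope_imp_closed by (auto simp: closed_def)
  then obtain e where "e > 0" "ball x e \<subseteq> - K"
    using False open_contains_ball by (metis ComplI)
  then have "y \<in> ball x e \<Longrightarrow> closed_segment x y \<subseteq> - K" for y
    using closed_segment_subset[of x "ball x e" y] by auto
  moreover have "\<forall>\<^sub>F y in nhds x. y \<in> ball x e"
    using \<open>e > 0\<close> by (intro eventually_nhds_in_open) auto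
  ultimately show ?thesis
    using interior_subset[of K] by (elim eventually_mono) blast
qed

lemma locally_star_domain:
  assumes "convex P0" "\<And>i. i \<in> I \<Longrightarrow> polytope (H i)" "finite I"
  shows "locally_star (P0 - (\<Union>i\<in>I. interior (H i)))"
  unfolding locally_star_def
proof
  fix x assume x: "x \<in> P0 - (\<Union>i\<in>I. interior (H i))"
  have "\<forall>\<^sub>F y in nhds x. \<forall>i\<in>I. y \<notin> interior (H i) \<longrightarrow> closed_segment x y \<inter> interior (H i) = {}"
    using assms by (intro eventually_ball_finite ballI polytope_complement_local) auto
  then show "\<forall>\<^sub>F y in nhds x. y \<in> P0 - (\<Union>i\<in>I. interior (H i)) \<longrightarrow>
      closed_segment x y \<subseteq> P0 - (\<Union>i\<in>I. interior (H i))"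
    by (rule eventually_mono) (use x closed_segment_subset[OF _ _ assms(1)] in blast)
qed

section \<open>Sliding along the side of a convex polygon\<close>

lemma inner_pt: "(a::pt) \<bullet> z = a $ 1 * z $ 1 + a $ 2 * z $ 2"
  by (simp add: inner_vec_def sum_2)

lemma pt_eq_iff: "(z::pt) = w \<longleftrightarrow> z $ 1 = w $ 1 \<and> z $ 2 = w $ 2"
  by (simp add: vec_eq_iff forall_2)

lemma dist_pt_le: "dist (z::pt) w \<le> \<bar>z $ 1 - w $ 1\<bar> + \<bar>z $ 2 - w $ 2\<bar>"
  using norm_le_l1_cart[of "z - w"] by (simp add: dist_norm sum_2)

lemma coord_diff_le: "\<bar>(z::pt) $ i - w $ i\<bar> \<le> dist z w"
  using component_le_norm_cart[of "z - w" i] by (simp add: dist_norm)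

definition bd_point :: "real \<Rightarrow> (real \<Rightarrow> real) \<Rightarrow> real \<Rightarrow> pt" where
  "bd_point \<sigma> f y = vector [\<sigma> * f y, y]"

lemma bd_point_nth [simp]: "bd_point \<sigma> f y $ 1 = \<sigma> * f y" "bd_point \<sigma> f y $ 2 = y"
  by (simp_all add: bd_point_def)

text \<open>For \<open>\<sigma> = 1\<close> the function \<open>f\<close> describes the left boundary of \<open>K\<close> as \<open>x = f y\<close>,
  for \<open>\<sigma> = -1\<close> the right boundary as \<open>x = - f y\<close>.\<close>
definition side_function :: "real \<Rightarrow> pt set \<Rightarrow> (real \<Rightarrow> real) \<Rightarrow> bool" where
  "side_function \<sigma> K f \<longleftrightarrow> continuous_on UNIV f \<and>
     (\<forall>z\<in>K. f (z $ 2) \<le> \<sigma> * z $ 1 \<and> bd_point \<sigma> f (z $ 2) \<in> K)"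

text \<open>Half-planes with \<open>\<sigma> * a $ 1 < 0\<close> bound the set from the side in
  question, and their boundary lines enter \<open>f\<close> through a maximum; the others survive a
  move towards that side. The maximum starts at \<open>M\<close>, since the empty family has no
  boundary. The claim covers all \<open>x\<close> above \<open>f\<close> because later half-planes
  may raise \<open>f\<close>.\<close>

lemma halfspaces_side_function:
  fixes F :: "pt set set"
  assumes \<sigma>: "\<sigma> * \<sigma> = (1::real)" and "finite F" "\<And>h. h \<in> F \<Longrightarrow> \<exists>a b. h = {x. a \<bullet> x \<le> b}"
  shows "\<exists>f. continuous_on UNIV f \<and>
    (\<forall>z\<in>\<Inter>F. M \<le> \<sigma> * z $ 1 \<longrightarrow> f (z $ 2) \<le> \<sigma> * z $ 1 \<and>
       (\<forall>x. f (z $ 2) \<le> x \<longrightarrow> x \<le> \<sigma> * z $ 1 \<longrightarrow> vector [\<sigma> * x, z $ 2] \<in> \<Inter>F))"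
  using assms(2,3)
proof (induction F rule: finite_induct)
  case empty
  show ?case by (rule exI[of _ "\<lambda>_. M"]) auto
next
  case (insert h F)
  obtain f where f0: "continuous_on UNIV f"
    "\<forall>z\<in>\<Inter>F. M \<le> \<sigma> * z $ 1 \<longrightarrow> f (z $ 2) \<le> \<sigma> * z $ 1 \<and>
       (\<forall>x. f (z $ 2) \<le> x \<longrightarrow> x \<le> \<sigma> * z $ 1 \<longrightarrow> vector [\<sigma> * x, z $ 2] \<in> \<Inter>F)"
    using insert.IH[OF insert.prems] by blast
  note f = f0(1) f0(2)[rule_format, THEN conjunct1] f0(2)[rule_format, THEN conjunct2, rule_format]
  obtain a b where h: "h = {x. a \<bullet> x \<le> b}" using insert by blast
  have \<sigma>2: "\<sigma> * (\<sigma> * t) = t" for t using \<sigma> by (simp flip: mult.assoc)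
  show ?case
  proof (cases "\<sigma> * a $ 1 < 0")
    case True
    define f' where "f' y = max (f y) ((b - a $ 2 * y) / (\<sigma> * a $ 1))" for y
    have bound: "(b - a $ 2 * y) / (\<sigma> * a $ 1) \<le> x \<longleftrightarrow> a $ 1 * (\<sigma> * x) + a $ 2 * y \<le> b" for x y
      using True by (simp add: divide_le_eq algebra_simps)
    have "continuous_on UNIV f'"
      unfolding f'_def using True by (intro continuous_intros f(1)) auto
    moreover have "f' (z $ 2) \<le> \<sigma> * z $ 1" if "z \<in> \<Inter>(insert h F)" "M \<le> \<sigma> * z $ 1" for z
      using that f(2)[of z] by (auto simp: f'_def bound h inner_pt \<sigma>2)
    moreover have "vector [\<sigma> * x, z $ 2] \<in> \<Inter>(insert h F)"
      if "z \<in> \<Inter>(insert h F)" "M \<le> \<sigma> * z $ 1" "f' (z $ 2) \<le> x" "x \<le> \<sigma> * z $ 1" for z x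
      using that f(3)[of z x] by (auto simp: f'_def bound h inner_pt)
    ultimately show ?thesis
      by (intro exI[of _ f'] conjI ballI impI allI) auto
  next
    case False
    have "vector [\<sigma> * x, z $ 2] \<in> \<Inter>(insert h F)"
      if "z \<in> \<Inter>(insert h F)" "M \<le> \<sigma> * z $ 1" "f (z $ 2) \<le> x" "x \<le> \<sigma> * z $ 1" for z x
    proof -
      have "(\<sigma> * a $ 1) * x \<le> (\<sigma> * a $ 1) * (\<sigma> * z $ 1)"
        using False that(4) by (intro mult_left_mono) auto
      also have "\<dots> = a $ 1 * z $ 1" using \<sigma>2 by (simp add: mult.commute mult.left_commute)
      finally show ?thesis using that f(3)[of z x] by (auto simp: h inner_pt mult_ac)
    qed
    then show ?thesis using f(1,2)
      by (intro exI[of _ f] conjI ballI impI allI) auto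
  qed
qed

lemma ex_side_function:
  assumes "\<sigma> = 1 \<or> \<sigma> = -1" "polytope K"
  shows "\<exists>f. side_function \<sigma> K f"
proof -
  obtain F where F: "finite F" "K = \<Inter>F" "\<And>h. h \<in> F \<Longrightarrow> \<exists>a b. a \<noteq> 0 \<and> h = {x. a \<bullet> x \<le> b}"
    using polytope_halfspaces[OF assms(2)] by blast
  obtain B where B: "\<And>z. z \<in> K \<Longrightarrow> norm z \<le> B"
    using polytope_imp_bounded[OF assms(2)] by (auto simp: bounded_iff)
  have M: "- B \<le> \<sigma> * z $ 1" if "z \<in> K" for z
    using B[OF that] component_le_norm_cart[of z 1] assms(1) by auto
  have "\<sigma> * \<sigma> = 1" using assms(1) by auto
  moreover have "\<exists>a b. h = {x. a \<bullet> x \<le> b}" if "h \<in> F" for h using F(3)[OF that] by blast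
  ultimately obtain f where
    f: "continuous_on UNIV f" "\<forall>z\<in>K. - B \<le> \<sigma> * z $ 1 \<longrightarrow> f (z $ 2) \<le> \<sigma> * z $ 1 \<and>
       (\<forall>x. f (z $ 2) \<le> x \<longrightarrow> x \<le> \<sigma> * z $ 1 \<longrightarrow> vector [\<sigma> * x, z $ 2] \<in> K)"
    using halfspaces_side_function[of \<sigma> F "- B"] F(1) unfolding F(2) by blast
  then show ?thesis unfolding side_function_def bd_point_def using M by (intro exI[of _ f]) auto
qed

lemma side_function_interior:
  assumes "\<sigma> = 1 \<or> \<sigma> = -1" "side_function \<sigma> K f" "z \<in> interior K"
  shows "f (z $ 2) < \<sigma> * z $ 1"
proof -
  obtain e where e: "e > 0" "ball z e \<subseteq> K" using assms(3) by (auto simp: mem_interior)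
  define w :: pt where "w = vector [z $ 1 - \<sigma> * (e / 2), z $ 2]"
  have "dist z w \<le> e / 2"
    using dist_pt_le[of z w] e(1) assms(1) by (auto simp: w_def)
  then have "w \<in> K" using e by (auto simp: subset_iff)
  then have "f (z $ 2) \<le> \<sigma> * (z $ 1 - \<sigma> * (e / 2))"
    using assms(2) unfolding side_function_def by (metis w_def vector_2)
  then show ?thesis using assms(1) e(1) by (auto simp: algebra_simps)
qed

lemma bd_point_not_interior:
  assumes "\<sigma> = 1 \<or> \<sigma> = -1" "side_function \<sigma> K f"
  shows "bd_point \<sigma> f y \<notin> interior K"
  using side_function_interior[OF assms, of "bd_point \<sigma> f y"] assms(1) by auto

section \<open>Minimizers of tilted functionals and monotonicity along the boundary\<close>

definition minimizes_on :: "('a \<Rightarrow> real) \<Rightarrow> 'a set \<Rightarrow> 'a \<Rightarrow> bool" where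
  "minimizes_on \<phi> K a \<longleftrightarrow> a \<in> K \<and> (\<forall>z\<in>K. \<phi> a \<le> \<phi> z)"

text \<open>For \<open>\<sigma> = 1\<close> this is the progress measure of the walk;
  \<open>\<sigma> = -1\<close> mirrors it for the right boundary of the outer polygon.\<close>

definition tilt :: "real \<Rightarrow> real \<Rightarrow> pt \<Rightarrow> real" where
  "tilt \<sigma> c z = \<sigma> * z $ 1 - c * z $ 2"

lemma tilt_bd_point: "\<sigma> = 1 \<or> \<sigma> = -1 \<Longrightarrow> tilt \<sigma> c (bd_point \<sigma> f y) = f y - c * y"
  by (auto simp: tilt_def)

text \<open>At the heights of \<open>K\<close> the function \<open>f y - c * y\<close> is convex
  with its minimum at the height of \<open>L\<close>, so it grows away from \<open>L\<close>. The
  proof compares the boundary with the point \<open>q\<close> at height \<open>u\<close> on the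
  chord from \<open>L\<close> to the boundary point at \<open>v\<close>.\<close>

lemma side_function_mono:
  assumes \<sigma>: "\<sigma> = 1 \<or> \<sigma> = -1" and f: "side_function \<sigma> K f" and "convex K"
    and L: "minimizes_on (tilt \<sigma> c) K L"
    and u: "u \<in> closed_segment (L $ 2) v" and v: "bd_point \<sigma> f v \<in> K"
  shows "bd_point \<sigma> f u \<in> K" and "f u - c * u \<le> f v - c * v"
proof -
  obtain t where t: "0 \<le> t" "t \<le> 1" "u = (1 - t) * L $ 2 + t * v"
    using u by (auto simp: in_segment)
  define q where "q = (1 - t) *\<^sub>R L + t *\<^sub>R bd_point \<sigma> f v"
  have q: "q \<in> K" using L v t \<open>convex K\<close>
    by (auto simp: q_def minimizes_on_def intro!: convexD)
  have q2: "q $ 2 = u" by (simp add: q_def t(3))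
  show "bd_point \<sigma> f u \<in> K" using f q q2 by (auto simp: side_function_def)
  have "f u \<le> \<sigma> * q $ 1" using f q q2 by (auto simp: side_function_def)
  then have "f u - c * u \<le> tilt \<sigma> c q" by (simp add: tilt_def q2)
  also have "\<dots> = (1 - t) * tilt \<sigma> c L + t * tilt \<sigma> c (bd_point \<sigma> f v)"
    by (simp add: tilt_def q_def algebra_simps)
  also have "\<dots> \<le> (1 - t) * tilt \<sigma> c (bd_point \<sigma> f v) + t * tilt \<sigma> c (bd_point \<sigma> f v)"
    using L v t by (intro add_mono mult_left_mono) (auto simp: minimizes_on_def)
  also have "\<dots> = f v - c * v" using \<sigma> by (simp add: tilt_bd_point algebra_simps)
  finally show "f u - c * u \<le> f v - c * v" .
qed

text \<open>Arc length is at most horizontal plus vertical variation. The horizontal variation is at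
  most the gain in \<open>f y - c * y\<close>, which is monotone along the arc, plus
  \<open>\<bar>c\<bar> \<le> 1\<close> times the vertical one; hence the factor 2.\<close>

lemma reach_side:
  assumes \<sigma>: "\<sigma> = 1 \<or> \<sigma> = -1" and f: "side_function \<sigma> K f" and "convex K"
    and star: "locally_star P" and P: "\<And>y. bd_point \<sigma> f y \<in> K \<Longrightarrow> bd_point \<sigma> f y \<in> P"
    and L: "minimizes_on (tilt \<sigma> c) K L" and c: "\<bar>c\<bar> \<le> 1"
    and u: "u \<in> closed_segment (L $ 2) v" and v: "bd_point \<sigma> f v \<in> K"
  shows "reach P (bd_point \<sigma> f u) (bd_point \<sigma> f v) ((f v - c * v) - (f u - c * u) + 2 * \<bar>v - u\<bar>)"
proof -
  let ?\<gamma> = "bd_point \<sigma> f"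
  note mono = side_function_mono[OF \<sigma> f \<open>convex K\<close> L]
  have cont: "continuous_on S ?\<gamma>" for S
  proof -
    have "continuous_on S f" using f by (auto simp: side_function_def intro: continuous_on_subset)
    then have "continuous_on S (\<lambda>y. (\<sigma> * f y) *\<^sub>R axis 1 1 + y *\<^sub>R (axis 2 1 :: pt))"
      by (intro continuous_intros)
    moreover have "(\<lambda>y. (\<sigma> * f y) *\<^sub>R axis 1 1 + y *\<^sub>R (axis 2 1 :: pt)) = ?\<gamma>"
      by (auto simp: pt_eq_iff axis_def)
    ultimately show ?thesis by (rule back_subst[of "continuous_on S"])
  qed
  have sub: "?\<gamma> ` {p..q} \<subseteq> P" if "{p..q} \<subseteq> closed_segment (L $ 2) v" for p q
    using mono(1)[OF _ v] P that by blast
  have d: "dist (?\<gamma> p) (?\<gamma> q) \<le> \<bar>(f p - c * p) - (f q - c * q)\<bar> + 2 * \<bar>p - q\<bar>" for p q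
  proof -
    define X where "X = c * (p - q)"
    have "dist (?\<gamma> p) (?\<gamma> q) \<le> \<bar>f p - f q\<bar> + \<bar>p - q\<bar>"
      using dist_pt_le[of "?\<gamma> p" "?\<gamma> q"] \<sigma> by auto
    moreover have "\<bar>X\<bar> \<le> 1 * \<bar>p - q\<bar>"
      unfolding abs_mult X_def using c by (intro mult_right_mono) auto
    moreover have "\<bar>f p - f q\<bar> \<le> \<bar>(f p - c * p) - (f q - c * q)\<bar> + \<bar>X\<bar>"
      using abs_triangle_ineq[of "(f p - c * p) - (f q - c * q)" X] by (simp add: X_def algebra_simps)
    ultimately show ?thesis by simp
  qed
  have mono': "f p - c * p \<le> f q - c * q"
    if "q \<in> closed_segment (L $ 2) v" "p \<in> closed_segment (L $ 2) q" for p q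
    using mono(2)[OF that(2)] mono(1)[OF that(1) v] by blast
  show ?thesis
  proof (cases "u \<le> v")
    case True
    then have uv: "L $ 2 \<le> u \<or> u = v" using u by (auto simp: closed_segment_eq_real_ivl split: if_splits)
    show ?thesis
    proof (cases "u = v")
      case True then show ?thesis by (auto intro: reach_refl)
    next
      case False
      with uv have Lu: "L $ 2 \<le> u" by auto
      have "reach P (?\<gamma> u) (?\<gamma> v) ((f v - c * v + 2 * v) - (f u - c * u + 2 * u))"
      proof (rule reach_curve[where m = "\<lambda>y. f y - c * y + 2 * y", OF star True cont sub])
        show "{u..v} \<subseteq> closed_segment (L $ 2) v" using Lu True by (auto simp: closed_segment_eq_real_ivl)
        fix p q assume "u \<le> p" "p \<le> q" "q \<le> v"
        then show "dist (?\<gamma> p) (?\<gamma> q) \<le> f q - c * q + 2 * q - (f p - c * p + 2 * p)"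
          using d[of p q] mono'[of q p] Lu by (auto simp: closed_segment_eq_real_ivl)
      qed
      then show ?thesis using True by (elim reach_mono) auto
    qed
  next
    case False
    then have Lu: "u \<le> L $ 2" using u by (auto simp: closed_segment_eq_real_ivl split: if_splits)
    \<comment> \<open>\<open>reach_curve\<close> runs through increasing parameters, so the arc
      below \<open>L\<close> is traversed upwards from \<open>v\<close> to \<open>u\<close> and then
      reversed.\<close>
    have "reach P (?\<gamma> v) (?\<gamma> u) ((2 * u - (f u - c * u)) - (2 * v - (f v - c * v)))"
    proof (rule reach_curve[where m = "\<lambda>y. 2 * y - (f y - c * y)", OF star _ cont sub])
      show "v \<le> u" using False by simp
      show "{v..u} \<subseteq> closed_segment (L $ 2) v" using Lu False by (auto simp: closed_segment_eq_real_ivl)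
      fix p q assume "v \<le> p" "p \<le> q" "q \<le> u"
      then show "dist (?\<gamma> p) (?\<gamma> q) \<le> (2 * q - (f q - c * q)) - (2 * p - (f p - c * p))"
        using d[of p q] mono'[of p q] Lu by (auto simp: closed_segment_eq_real_ivl)
    qed
    then show ?thesis using False by (intro reach_sym[of _ "?\<gamma> v"]) (elim reach_mono, auto)
  qed
qed

text \<open>Adding the two minimality inequalities shows that the minimizer moves up as the slope
  grows.\<close>

lemma minimizer_shift:
  assumes "minimizes_on (tilt \<sigma> c) K L" "minimizes_on (tilt \<sigma> (c + \<alpha>)) K A"
  shows "0 \<le> \<alpha> * (A $ 2 - L $ 2)"
proof -
  have "tilt \<sigma> c L \<le> tilt \<sigma> c A" "tilt \<sigma> (c + \<alpha>) A \<le> tilt \<sigma> (c + \<alpha>) L"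
    using assms by (auto simp: minimizes_on_def)
  then show ?thesis by (simp add: tilt_def algebra_simps)
qed

text \<open>Beyond the minimizer \<open>A\<close> the boundary has slope at least \<open>\<alpha>\<close> against \<open>tilt \<sigma> c\<close>, so only the
  part between \<open>L\<close> and \<open>A\<close> can be climbed without paying for it by a gain of \<open>tilt \<sigma> c\<close>.\<close>
lemma side_function_excess:
  assumes \<sigma>: "\<sigma> = 1 \<or> \<sigma> = -1" and f: "side_function \<sigma> K f" and "convex K"
    and L: "minimizes_on (tilt \<sigma> c) K L" and A: "minimizes_on (tilt \<sigma> (c + \<alpha>)) K A"
    and p: "p \<in> closed_segment (L $ 2) v" and AL: "A $ 2 \<in> closed_segment (L $ 2) v"
    and v: "bd_point \<sigma> f v \<in> K"
  shows "\<alpha> * (v - p) \<le> (f v - c * v) - (f p - c * p) + \<alpha> * (A $ 2 - L $ 2)"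
proof -
  note monoL = side_function_mono[OF \<sigma> f \<open>convex K\<close> L]
  note monoA = side_function_mono[OF \<sigma> f \<open>convex K\<close> A]
  note shift = minimizer_shift[OF L A]
  consider "p \<in> closed_segment (A $ 2) v" | "p \<in> closed_segment (L $ 2) (A $ 2)"
    using p AL unfolding closed_segment_eq_real_ivl by (smt (verit) atLeastAtMost_iff)
  then show ?thesis
  proof cases
    case 1
    from monoA(2)[OF this v] shift show ?thesis by (simp add: algebra_simps)
  next
    case 2
    have a: "f (A $ 2) - (c + \<alpha>) * A $ 2 \<le> f v - (c + \<alpha>) * v"
      by (rule monoA(2)[OF _ v]) simp
    have b: "f p - c * p \<le> f (A $ 2) - c * A $ 2"
      by (rule monoL(2)[OF 2 monoL(1)[OF AL v]])
    obtain t where t: "0 \<le> t" "p = (1 - t) * L $ 2 + t * A $ 2"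
      using 2 by (auto simp: in_segment)
    have "0 \<le> t * (\<alpha> * (A $ 2 - L $ 2))" using t(1) shift by simp
    then have "\<alpha> * L $ 2 \<le> \<alpha> * p" by (simp add: t(2) algebra_simps)
    with a b show ?thesis by (simp add: algebra_simps)
  qed
qed

section \<open>The walk to the right\<close>

lemma horizontal_segment:
  assumes "(z::pt) $ 2 = w $ 2" "z $ 1 \<le> w $ 1"
  shows "q \<in> closed_segment z w \<longleftrightarrow> q $ 2 = z $ 2 \<and> z $ 1 \<le> q $ 1 \<and> q $ 1 \<le> w $ 1"
proof
  assume "q \<in> closed_segment z w"
  then obtain t where t: "0 \<le> t" "t \<le> 1" "q = (1 - t) *\<^sub>R z + t *\<^sub>R w" by (auto simp: in_segment)
  have "q $ 1 = z $ 1 + t * (w $ 1 - z $ 1)" "q $ 1 = w $ 1 - (1 - t) * (w $ 1 - z $ 1)"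
    by (simp_all add: t(3) algebra_simps)
  moreover have "0 \<le> t * (w $ 1 - z $ 1)" "0 \<le> (1 - t) * (w $ 1 - z $ 1)"
    using t assms by auto
  ultimately show "q $ 2 = z $ 2 \<and> z $ 1 \<le> q $ 1 \<and> q $ 1 \<le> w $ 1"
    using assms(1) by (auto simp: t(3) algebra_simps)
next
  assume q: "q $ 2 = z $ 2 \<and> z $ 1 \<le> q $ 1 \<and> q $ 1 \<le> w $ 1"
  then have "q $ 1 \<in> closed_segment (z $ 1) (w $ 1)" by (simp add: closed_segment_eq_real_ivl)
  then obtain t where t: "0 \<le> t" "t \<le> 1" "q $ 1 = (1 - t) * z $ 1 + t * w $ 1"
    by (auto simp: in_segment)
  then have "q = (1 - t) *\<^sub>R z + t *\<^sub>R w"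
    using q assms(1) by (simp add: pt_eq_iff algebra_simps)
  then show "q \<in> closed_segment z w" using t by (auto simp: in_segment)
qed

lemma interior_vertical_room:
  assumes "(q::pt) \<in> interior K"
  shows "\<exists>a\<in>K. q $ 2 < a $ 2" "\<exists>b\<in>K. b $ 2 < q $ 2"
proof -
  obtain e where e: "e > 0" "ball q e \<subseteq> K" using assms by (auto simp: mem_interior)
  have "vector [q $ 1, q $ 2 + d] \<in> K" if "\<bar>d\<bar> \<le> e / 2" for d
  proof -
    have "dist q (vector [q $ 1, q $ 2 + d]) \<le> e / 2"
      using dist_pt_le[of q "vector [q $ 1, q $ 2 + d]"] that by auto
    then show ?thesis using e by (auto simp: subset_iff)
  qed
  from this[of "e/2"] this[of "- e/2"] e(1)
  show "\<exists>a\<in>K. q $ 2 < a $ 2" "\<exists>b\<in>K. b $ 2 < q $ 2"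
    by (force intro: bexI[rotated])+
qed

lemma ex_minimizes_on:
  fixes K :: "pt set"
  assumes "compact K" "K \<noteq> {}" "continuous_on K \<phi>"
  shows "\<exists>a. minimizes_on \<phi> K a"
  using continuous_attains_inf[OF assms] by (auto simp: minimizes_on_def)

lemma continuous_on_tilt: "continuous_on K (tilt \<sigma> c)"
  unfolding tilt_def by (intro continuous_intros)

locale holed_polygon =
  fixes P0 :: "pt set" and H :: "nat \<Rightarrow> pt set" and h :: nat and P :: "pt set"
  assumes outer: "convex_polygon P0"
    and hole: "i \<in> {1..h} \<Longrightarrow> convex_polygon (H i)"
    and hole_inside: "i \<in> {1..h} \<Longrightarrow> H i \<subseteq> interior P0"
    and disjoint: "i \<in> {1..h} \<Longrightarrow> j \<in> {1..h} \<Longrightarrow> i \<noteq> j \<Longrightarrow> H i \<inter> H j = {}"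
    and P_eq: "P = P0 - (\<Union>i\<in>{1..h}. interior (H i))"
begin

lemma convex_outer: "convex P0"
  using outer by (simp add: convex_polygon_def polytope_imp_convex)

lemma hole_props:
  assumes "i \<in> {1..h}"
  shows "polytope (H i)" "convex (H i)" "compact (H i)" "H i \<noteq> {}"
  using hole[OF assms] interior_subset[of "H i"]
  by (auto simp: convex_polygon_def polytope_imp_convex polytope_imp_compact)

lemma star: "locally_star P"
  unfolding P_eq using convex_outer hole_props(1) by (intro locally_star_domain) auto

lemma hole_boundary_in: "i \<in> {1..h} \<Longrightarrow> p \<in> H i \<Longrightarrow> p \<notin> interior (H i) \<Longrightarrow> p \<in> P"
  using hole_inside[of i] disjoint[of i] interior_subset unfolding P_eq by blast

lemma outer_boundary_in: "p \<in> P0 \<Longrightarrow> p \<notin> interior P0 \<Longrightarrow> p \<in> P"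
  using hole_inside interior_subset unfolding P_eq by blast

end

text \<open>Here \<open>c\<close> is the slope of the progress measure and \<open>\<alpha>\<close>
  the rate of gain demanded of a slide; \<open>U\<close> and \<open>D\<close> are the minimizers for
  the slopes shifted by \<open>\<alpha>\<close>. The points \<open>E i True\<close> and
  \<open>E i False\<close> are the leftmost highest and leftmost lowest points of hole
  \<open>i\<close>, where slides end.\<close>

locale walk = holed_polygon +
  fixes c \<alpha> :: real and L U D :: "nat \<Rightarrow> pt" and f :: "nat \<Rightarrow> real \<Rightarrow> real" and r :: "real \<Rightarrow> real"
    and E :: "nat \<Rightarrow> bool \<Rightarrow> pt"
  assumes c: "\<bar>c\<bar> \<le> 1" and \<alpha>: "0 < \<alpha>"
    and L: "i \<in> {1..h} \<Longrightarrow> minimizes_on (tilt 1 c) (H i) (L i)"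
    and U: "i \<in> {1..h} \<Longrightarrow> minimizes_on (tilt 1 (c + \<alpha>)) (H i) (U i)"
    and D: "i \<in> {1..h} \<Longrightarrow> minimizes_on (tilt 1 (c - \<alpha>)) (H i) (D i)"
    and f: "i \<in> {1..h} \<Longrightarrow> side_function 1 (H i) (f i)"
    and r: "side_function (- 1) P0 r"
    and E: "i \<in> {1..h} \<Longrightarrow> E i b \<in> H i" "i \<in> {1..h} \<Longrightarrow> E i b = bd_point 1 (f i) (E i b $ 2)"
      "i \<in> {1..h} \<Longrightarrow> z \<in> H i \<Longrightarrow> E i False $ 2 \<le> z $ 2 \<and> z $ 2 \<le> E i True $ 2"
begin

abbreviation "\<xi> \<equiv> tilt 1 c"

text \<open>Height of the arc, upwards from \<open>L i\<close> for \<open>True\<close> and downwards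
  for \<open>False\<close>, on which the gain in \<open>\<xi>\<close> may stay below rate
  \<open>\<alpha>\<close>.\<close>

definition excess :: "nat \<times> bool \<Rightarrow> real" where
  "excess = (\<lambda>(i, b). if b then U i $ 2 - L i $ 2 else L i $ 2 - D i $ 2)"

lemma excess_nonneg: "i \<in> {1..h} \<Longrightarrow> 0 \<le> excess (i, b)"
  using minimizer_shift[OF L U, of i] minimizer_shift[of 1 c "H i" "L i" "- \<alpha>" "D i"] L[of i] D[of i] \<alpha>
  by (auto simp: excess_def zero_le_mult_iff mult_le_0_iff)

text \<open>The slide leads away from \<open>L i\<close>, so \<open>\<xi>\<close> cannot drop. If
  \<open>d\<close> is the gain in \<open>\<xi>\<close>, then \<open>side_function_excess\<close>
  bounds the height of the slide by \<open>d / \<alpha> + excess (i, b)\<close>, and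
  \<open>reach_side\<close> bounds its length by \<open>d\<close> plus twice this height.\<close>

lemma slide:
  assumes i: "i \<in> {1..h}" and p: "bd_point 1 (f i) y \<in> H i"
  defines "b \<equiv> L i $ 2 \<le> y"
  shows "\<xi> (bd_point 1 (f i) y) \<le> \<xi> (E i b)"
    and "reach P (bd_point 1 (f i) y) (E i b)
          ((1 + 2 / \<alpha>) * (\<xi> (E i b) - \<xi> (bd_point 1 (f i) y)) + 2 * excess (i, b))"
proof -
  define v where "v = E i b $ 2"
  have v: "bd_point 1 (f i) v = E i b" "bd_point 1 (f i) v \<in> H i" using E(1,2) i by (auto simp: v_def)
  have LH: "L i \<in> H i" and UH: "U i \<in> H i" and DH: "D i \<in> H i"
    using L[OF i] U[OF i] D[OF i] by (auto simp: minimizes_on_def)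
  have y: "y \<in> closed_segment (L i $ 2) v"
    using E(3)[OF i p] E(3)[OF i LH]
    by (cases b) (auto simp: v_def b_def[symmetric] closed_segment_eq_real_ivl, auto simp: b_def)
  note mono = side_function_mono[OF _ f[OF i] hole_props(2)[OF i] L[OF i] y v(2)]
  show le: "\<xi> (bd_point 1 (f i) y) \<le> \<xi> (E i b)"
    unfolding v(1)[symmetric] using mono(2) by (simp add: tilt_bd_point)
  define d where "d = \<xi> (E i b) - \<xi> (bd_point 1 (f i) y)"
  have d: "d = (f i v - c * v) - (f i y - c * y)"
    unfolding d_def v(1)[symmetric] by (simp add: tilt_bd_point)
  have reach: "reach P (bd_point 1 (f i) y) (E i b) (d + 2 * \<bar>v - y\<bar>)"
    using reach_side[OF _ f[OF i] hole_props(2)[OF i] star _ L[OF i] c y v(2)]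
      hole_boundary_in[OF i] bd_point_not_interior[OF _ f[OF i]] v(1) by (simp add: d)
  have "\<alpha> * \<bar>v - y\<bar> \<le> d + \<alpha> * excess (i, b)"
  proof (cases b)
    case True
    have "U i $ 2 \<in> closed_segment (L i $ 2) v"
      using E(3)[OF i UH] E(3)[OF i LH] minimizer_shift[OF L[OF i] U[OF i]] \<alpha> True
      by (auto simp: v_def closed_segment_eq_real_ivl zero_le_mult_iff)
    from side_function_excess[OF _ f[OF i] hole_props(2)[OF i] L[OF i] U[OF i] y this v(2)]
    show ?thesis using True E(3)[OF i p] by (simp add: d excess_def v_def abs_if)
  next
    case False
    have D': "minimizes_on (tilt 1 (c + - \<alpha>)) (H i) (D i)" using D[OF i] by simp
    have "D i $ 2 \<in> closed_segment (L i $ 2) v"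
      using E(3)[OF i DH] E(3)[OF i LH] minimizer_shift[OF L[OF i] D'] \<alpha> False
      by (auto simp: v_def closed_segment_eq_real_ivl mult_le_0_iff)
    from side_function_excess[OF _ f[OF i] hole_props(2)[OF i] L[OF i] D' y this v(2)]
    moreover have "\<bar>v - y\<bar> = y - v" using False E(3)[OF i p] by (simp add: v_def)
    ultimately show ?thesis using False by (simp add: d excess_def algebra_simps)
  qed
  then have "\<bar>v - y\<bar> \<le> d / \<alpha> + excess (i, b)"
    using \<alpha> by (simp add: field_simps)
  moreover have "(1 + 2 / \<alpha>) * d = d + 2 * (d / \<alpha>)" by (simp add: algebra_simps)
  ultimately have "d + 2 * \<bar>v - y\<bar> \<le> (1 + 2 / \<alpha>) * d + 2 * excess (i, b)"
    by (smt (verit))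
  with reach show "reach P (bd_point 1 (f i) y) (E i b)
          ((1 + 2 / \<alpha>) * (\<xi> (E i b) - \<xi> (bd_point 1 (f i) y)) + 2 * excess (i, b))"
    unfolding d_def[symmetric] by (rule reach_mono)
qed

text \<open>Only holes whose interior meets the ray block it, and the one with the least
  \<open>f i (z $ 2)\<close> is met first. A hit through the interior places \<open>z\<close>
  strictly between the extreme heights of the hole, which later shows that a slide really changes
  the height.\<close>

lemma first_hit:
  assumes z: "z \<in> P"
  obtains (exit) "bd_point (-1) r (z $ 2) \<in> P0" "z $ 1 \<le> bd_point (-1) r (z $ 2) $ 1"
      "closed_segment z (bd_point (-1) r (z $ 2)) \<subseteq> P"
  | (hit) i where "i \<in> {1..h}" "bd_point 1 (f i) (z $ 2) \<in> H i" "z $ 1 \<le> f i (z $ 2)"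
      "closed_segment z (bd_point 1 (f i) (z $ 2)) \<subseteq> P"
      "E i False $ 2 < z $ 2" "z $ 2 < E i True $ 2"
proof -
  define w where "w = bd_point (-1) r (z $ 2)"
  have z0: "z \<in> P0" using z P_eq by auto
  then have w: "w \<in> P0" "z $ 1 \<le> w $ 1" "z $ 2 = w $ 2"
    using r by (auto simp: side_function_def w_def)
  define J where "J = {i \<in> {1..h}. \<exists>q\<in>interior (H i). q $ 2 = z $ 2 \<and> z $ 1 \<le> q $ 1}"
  have seg0: "closed_segment z q \<subseteq> P0" if "q \<in> P0" for q
    using closed_segment_subset[OF z0 that convex_outer] .
  show thesis
  proof (cases "J = {}")
    case True
    have "q \<notin> interior (H i)" if "q \<in> closed_segment z w" "i \<in> {1..h}" for q i
      using True that horizontal_segment[OF w(3,2), of q] by (auto simp: J_def)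
    then have "closed_segment z w \<subseteq> P"
      using seg0[OF w(1)] unfolding P_eq by blast
    then show thesis by (rule exit[folded w_def, OF w(1,2)])
  next
    case False
    have "finite J" by (auto simp: J_def)
    then obtain i where i: "i \<in> J" "\<And>j. j \<in> J \<Longrightarrow> f i (z $ 2) \<le> f j (z $ 2)"
      using ex_is_arg_min_if_finite[of J "\<lambda>i. f i (z $ 2)"] False
      by (metis is_arg_min_linorder)
    then obtain q where I: "i \<in> {1..h}" and q: "q \<in> interior (H i)" "q $ 2 = z $ 2" "z $ 1 \<le> q $ 1"
      by (auto simp: J_def)
    define p where "p = bd_point 1 (f i) (z $ 2)"
    have qH: "q \<in> H i" using q(1) interior_subset by blast
    have p: "p \<in> H i" "p $ 2 = z $ 2" "p $ 1 = f i (z $ 2)"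
      using f[OF I] qH q(2) by (auto simp: side_function_def p_def)
    have pq: "p $ 1 < q $ 1"
      using side_function_interior[OF _ f[OF I] q(1)] q(2) by (simp add: p(3))
    \<comment> \<open>Otherwise \<open>z\<close> lies between \<open>p\<close> and the interior
      point \<open>q\<close>, hence in the interior of the hole by convexity.\<close>
    have zp: "z $ 1 \<le> p $ 1"
    proof (rule ccontr)
      assume "\<not> z $ 1 \<le> p $ 1"
      then have "z \<in> closed_segment p q" "z \<noteq> p"
        using horizontal_segment[of p q z] p q pq by auto
      then have "z = q \<or> z \<in> open_segment q p"
        by (auto simp: open_segment_def closed_segment_commute)
      then have "z \<in> interior (H i)"
        using in_interior_closure_convex_segment[OF hole_props(2)[OF I] q(1)] p(1) q(1) closure_subset
        by blast
      then show False using z I P_eq by auto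
    qed
    have "p \<in> P0" using p(1) hole_inside[OF I] interior_subset by blast
    have "x \<notin> interior (H j)" if x: "x \<in> closed_segment z p" and j: "j \<in> {1..h}" for x j
    proof
      assume xj: "x \<in> interior (H j)"
      have x': "x $ 2 = z $ 2" "z $ 1 \<le> x $ 1" "x $ 1 \<le> p $ 1"
        using horizontal_segment[of z p x] p(2) zp x by auto
      then have "j \<in> J" using j xj by (auto simp: J_def)
      then have "f i (z $ 2) \<le> f j (z $ 2)" by (rule i(2))
      also have "\<dots> < x $ 1" using side_function_interior[OF _ f[OF j] xj] x'(1) by simp
      finally show False using x'(3) p(3) by simp
    qed
    then have "closed_segment z p \<subseteq> P"
      using seg0[OF \<open>p \<in> P0\<close>] unfolding P_eq by blast
    moreover have "E i False $ 2 < z $ 2" "z $ 2 < E i True $ 2"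
      using interior_vertical_room[OF q(1)] E(3)[OF I] q(2) by force+
    ultimately show thesis by (rule hit[OF I, folded p_def, OF p(1) zp[unfolded p(3)]])
  qed
qed

text \<open>The end points of slides that the walk may still visit; \<open>E i b \<noteq> z\<close> removes the
  one just reached, so the set shrinks with every slide.\<close>
definition ahead :: "pt \<Rightarrow> (nat \<times> bool) set" where
  "ahead z = {(i, b). i \<in> {1..h} \<and> \<xi> z \<le> \<xi> (E i b) \<and> E i b \<noteq> z}"

lemma finite_ahead: "finite (ahead z)"
  by (rule finite_subset[of _ "{1..h} \<times> UNIV"]) (auto simp: ahead_def)

text \<open>Induction on the number of slide ends still ahead. Horizontal steps are paid for by
  their gain in \<open>\<xi>\<close>; a slide also spends the excess of the end it reaches, which
  then leaves \<open>ahead\<close>. The gains in \<open>\<xi>\<close> telescope.\<close>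

lemma walk_right:
  "z \<in> P \<Longrightarrow> \<exists>y. bd_point (-1) r y \<in> P0 \<and>
     reach P z (bd_point (-1) r y)
       ((1 + 2 / \<alpha>) * (\<xi> (bd_point (-1) r y) - \<xi> z) + 2 * sum excess (ahead z))"
proof (induction "card (ahead z)" arbitrary: z rule: less_induct)
  case less
  have k: "1 \<le> 1 + 2 / \<alpha>" using \<alpha> by simp
  have ex0: "0 \<le> sum excess (ahead z)" for z
    by (rule sum_nonneg) (auto simp: ahead_def excess_nonneg)
  show ?case using less.prems
  proof (cases rule: first_hit)
    case exit
    let ?w = "bd_point (-1) r (z $ 2)"
    have "dist z ?w \<le> \<xi> ?w - \<xi> z"
      using dist_pt_le[of z ?w] exit(2) by (simp add: tilt_def)
    also have "\<dots> \<le> (1 + 2 / \<alpha>) * (\<xi> ?w - \<xi> z) + 2 * sum excess (ahead z)"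
      using k exit(2) ex0[of z] mult_right_mono[OF k, of "\<xi> ?w - \<xi> z"] by (auto simp: tilt_def)
    finally show ?thesis using reach_mono[OF reach_segment[OF exit(3)]] exit(1) by blast
  next
    case (hit i)
    define p where "p = bd_point 1 (f i) (z $ 2)"
    define b where "b \<longleftrightarrow> L i $ 2 \<le> z $ 2"
    define T where "T = E i b"
    have pP: "p \<in> H i" "p $ 2 = z $ 2" "z $ 1 \<le> p $ 1" using hit by (auto simp: p_def)
    have T: "\<xi> p \<le> \<xi> T" "reach P p T ((1 + 2 / \<alpha>) * (\<xi> T - \<xi> p) + 2 * excess (i, b))"
      using slide[OF hit(1,2)] by (auto simp: p_def b_def T_def)
    have zp: "\<xi> z \<le> \<xi> p" using pP by (simp add: tilt_def)
    have TP: "T \<in> P" unfolding T_def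
      using hole_boundary_in[OF hit(1) E(1)[OF hit(1)]] bd_point_not_interior[OF _ f[OF hit(1)]]
        E(2)[OF hit(1), of b] by metis
    have Ene: "E i b' \<noteq> q" if "q $ 2 = z $ 2" for b' q
      using hit(5,6) that by (cases b') auto
    have "(i, b) \<in> ahead z" using T(1) zp Ene[of z] hit(1) by (auto simp: ahead_def T_def)
    have "ahead T \<subseteq> ahead z - {(i, b)}"
    proof safe
      fix j b' assume "(j, b') \<in> ahead T"
      then have j: "j \<in> {1..h}" "\<xi> T \<le> \<xi> (E j b')" "E j b' \<noteq> T" by (auto simp: ahead_def)
      \<comment> \<open>Returning to \<open>z\<close> would make all gains zero, so
        \<open>p = z\<close> and \<open>z\<close> would lie in both holes. Disjointness gives
        \<open>i = j\<close>, but \<open>z\<close> is strictly between the extreme heights of hole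
        \<open>i\<close>.\<close>
      have "E j b' \<noteq> z"
      proof
        assume Ez: "E j b' = z"
        then have "\<xi> p = \<xi> z" using j T(1) zp by auto
        then have "p = z" using pP(2) by (simp add: pt_eq_iff tilt_def)
        then have "z \<in> H i \<inter> H j" using pP(1) E(1)[OF j(1), of b'] Ez by auto
        then have "i = j" using disjoint[OF hit(1) j(1)] by auto
        then show False using Ene[of z] Ez by auto
      qed
      then show "(j, b') \<in> ahead z" using j T(1) zp by (auto simp: ahead_def)
    next
      assume "(i, b) \<in> ahead T" then show False by (auto simp: ahead_def T_def)
    qed
    then have sub: "ahead T \<subset> ahead z" and ins: "insert (i, b) (ahead T) \<subseteq> ahead z"
      and nin: "(i, b) \<notin> ahead T"
      using \<open>(i, b) \<in> ahead z\<close> by auto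
    from less.hyps[OF psubset_card_mono[OF finite_ahead sub] TP] obtain y where
      y: "bd_point (-1) r y \<in> P0"
      "reach P T (bd_point (-1) r y) ((1 + 2 / \<alpha>) * (\<xi> (bd_point (-1) r y) - \<xi> T) + 2 * sum excess (ahead T))"
      by blast
    have "dist z p \<le> \<xi> p - \<xi> z"
      using dist_pt_le[of z p] pP by (simp add: tilt_def)
    also have "\<dots> \<le> (1 + 2 / \<alpha>) * (\<xi> p - \<xi> z)" using mult_right_mono[OF k, of "\<xi> p - \<xi> z"] zp by auto
    finally have zp': "reach P z p ((1 + 2 / \<alpha>) * (\<xi> p - \<xi> z))"
      using reach_mono[OF reach_segment] hit(4) by (auto simp: p_def)
    have "excess (i, b) + sum excess (ahead T) = sum excess (insert (i, b) (ahead T))"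
      using nin finite_ahead by simp
    also have "\<dots> \<le> sum excess (ahead z)"
      using finite_ahead ins by (intro sum_mono2) (auto simp: ahead_def excess_nonneg)
    finally have ex: "excess (i, b) + sum excess (ahead T) \<le> sum excess (ahead z)" .
    have "reach P z (bd_point (-1) r y) ((1 + 2 / \<alpha>) * (\<xi> p - \<xi> z) +
        (((1 + 2 / \<alpha>) * (\<xi> T - \<xi> p) + 2 * excess (i, b)) +
        ((1 + 2 / \<alpha>) * (\<xi> (bd_point (-1) r y) - \<xi> T) + 2 * sum excess (ahead T))))"
      by (intro reach_trans[OF zp'] reach_trans[OF T(2)] y(2))
    then have "reach P z (bd_point (-1) r y)
      ((1 + 2 / \<alpha>) * (\<xi> (bd_point (-1) r y) - \<xi> z) + 2 * sum excess (ahead z))"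
      by (rule reach_mono) (use ex in \<open>simp add: right_diff_distrib\<close>)
    with y(1) show ?thesis by blast
  qed
qed

end

section \<open>The upper bound\<close>

text \<open>For minimizer heights at consecutive slopes, \<open>a (k + 2) - a k\<close> is the total
  exceptional height of a hole at the middle slope. Neighbouring differences overlap, so two terms
  survive at each end.\<close>

lemma telescope_two_steps:
  fixes a :: "nat \<Rightarrow> real"
  shows "(\<Sum>k<N. a (k + 2) - a k) = a (N + 1) + a N - a 1 - a 0"
  by (induction N) (auto simp: algebra_simps)

lemma (in walk) sum_excess_ahead_le:
  "sum excess (ahead z) \<le> (\<Sum>i\<in>{1..h}. U i $ 2 - D i $ 2)"
proof -
  have "sum excess (ahead z) \<le> sum excess ({1..h} \<times> UNIV)"
    by (rule sum_mono2) (auto simp: ahead_def excess_nonneg)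
  also have "\<dots> = (\<Sum>i\<in>{1..h}. \<Sum>b\<in>UNIV. excess (i, b))"
    by (simp add: sum.cartesian_product)
  also have "\<dots> = (\<Sum>i\<in>{1..h}. U i $ 2 - D i $ 2)"
    by (simp add: UNIV_bool excess_def)
  finally show ?thesis .
qed

text \<open>Both points walk to the right boundary of \<open>P0\<close> and are joined there through
  one common point. As \<open>\<bar>c\<bar> \<le> 1\<close>, the gain in \<open>\<xi>\<close> is at
  most \<open>2 * d\<close>, so a walk costs \<open>2 * d + 4 * d / \<alpha> + 2 * X\<close> and the
  boundary arc another \<open>3 * d\<close>, each twice.\<close>

lemma (in walk) reach_walk:
  assumes s: "s \<in> P" and t: "t \<in> P" and d: "\<And>z w. z \<in> P0 \<Longrightarrow> w \<in> P0 \<Longrightarrow> dist z w \<le> d"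
    and X: "(\<Sum>i\<in>{1..h}. U i $ 2 - D i $ 2) \<le> X"
  shows "reach P s t (10 * d + 8 * d / \<alpha> + 4 * X)"
proof -
  have P0: "polytope P0" "compact P0" "P0 \<noteq> {}" using outer s P_eq
    by (auto simp: convex_polygon_def polytope_imp_compact)
  \<comment> \<open>\<open>M\<close> is a rightmost point of \<open>P0\<close>, so
    \<open>reach_side\<close> with slope 0 joins its height to any end on the right boundary at cost
    \<open>d + 2 * d\<close>.\<close>
  obtain M where M: "minimizes_on (tilt (-1) 0) P0 M"
    using ex_minimizes_on[OF P0(2,3) continuous_on_tilt] by blast
  have side: "reach P (bd_point (-1) r (M $ 2)) (bd_point (-1) r y) (3 * d)"
    if y: "bd_point (-1) r y \<in> P0" for y
  proof -
    let ?m = "bd_point (-1) r (M $ 2)" and ?y = "bd_point (-1) r y"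
    have m: "?m \<in> P0" using r M by (auto simp: minimizes_on_def side_function_def)
    have "reach P ?m ?y ((r y - 0 * y) - (r (M $ 2) - 0 * M $ 2) + 2 * \<bar>y - M $ 2\<bar>)"
      using outer_boundary_in bd_point_not_interior[OF _ r]
      by (intro reach_side[OF _ r convex_outer star _ M _ _ y]) auto
    moreover have "\<bar>r y - r (M $ 2)\<bar> \<le> d" "\<bar>y - M $ 2\<bar> \<le> d"
      using d[OF y m] coord_diff_le[of ?y 1 ?m] coord_diff_le[of ?y 2 ?m] by auto
    ultimately show ?thesis by (elim reach_mono) (smt (verit) mult_zero_left)
  qed
  have to_M: "reach P z (bd_point (-1) r (M $ 2)) (5 * d + 4 * d / \<alpha> + 2 * X)" if z: "z \<in> P" for z
  proof -
    from walk_right[OF z] obtain y where y: "bd_point (-1) r y \<in> P0"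
      "reach P z (bd_point (-1) r y) ((1 + 2 / \<alpha>) * (\<xi> (bd_point (-1) r y) - \<xi> z) + 2 * sum excess (ahead z))"
      by blast
    let ?w = "bd_point (-1) r y"
    have "dist ?w z \<le> d" using d y(1) z P_eq by auto
    then have x: "?w $ 1 - z $ 1 \<le> d" "\<bar>?w $ 2 - z $ 2\<bar> \<le> d"
      using coord_diff_le[of ?w 1 z] coord_diff_le[of ?w 2 z] by auto
    have "\<bar>c * (?w $ 2 - z $ 2)\<bar> \<le> 1 * d" unfolding abs_mult
      using c x(2) by (intro mult_mono) auto
    then have "\<xi> ?w - \<xi> z \<le> 2 * d" using x(1) by (auto simp: tilt_def algebra_simps)
    then have "(1 + 2 / \<alpha>) * (\<xi> ?w - \<xi> z) \<le> (1 + 2 / \<alpha>) * (2 * d)"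
      using \<alpha> by (intro mult_left_mono) auto
    moreover have "(1 + 2 / \<alpha>) * (2 * d) = 2 * d + 4 * d / \<alpha>" by (simp add: algebra_simps)
    ultimately have "(1 + 2 / \<alpha>) * (\<xi> ?w - \<xi> z) + 2 * sum excess (ahead z) + 3 * d
        \<le> 5 * d + 4 * d / \<alpha> + 2 * X"
      using sum_excess_ahead_le[of z] X by linarith
    then show ?thesis by (rule reach_mono[OF reach_trans[OF y(2) reach_sym[OF side[OF y(1)]]]])
  qed
  from reach_trans[OF to_M[OF s] reach_sym[OF to_M[OF t]]] show ?thesis
    by (rule reach_mono) auto
qed

section \<open>Averaging over the slopes\<close>

context holed_polygon
begin

lemma ex_extremal_heights:
  assumes "i \<in> {1..h}" "side_function 1 (H i) f"
  shows "\<exists>e :: bool \<Rightarrow> pt. \<forall>b. e b \<in> H i \<and> e b = bd_point 1 f (e b $ 2) \<and>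
           (\<forall>z\<in>H i. e False $ 2 \<le> z $ 2 \<and> z $ 2 \<le> e True $ 2)"
proof -
  have "continuous_on (H i) (\<lambda>z. - z $ 2)" "continuous_on (H i) (\<lambda>z. z $ 2)"
    by (intro continuous_intros)+
  from this[THEN ex_minimizes_on[OF hole_props(3,4)[OF assms(1)]]] obtain T B where
    T: "minimizes_on (\<lambda>z. - z $ 2) (H i) T" and B: "minimizes_on (\<lambda>z. z $ 2) (H i) B"
    by blast
  show ?thesis
    using T B assms(2)
    by (intro exI[of _ "\<lambda>b. bd_point 1 f ((if b then T else B) $ 2)"])
      (auto simp: minimizes_on_def side_function_def)
qed

text \<open>The pigeonhole principle chooses among the \<open>N\<close> slopes
  \<open>(k + 1) / N\<close> one whose total exceptional height \<open>W k\<close> is at most the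
  average \<open>2 * h * d / N\<close>.\<close>

lemma reach_all:
  assumes s: "s \<in> P" and t: "t \<in> P" and d: "\<And>z w. z \<in> P0 \<Longrightarrow> w \<in> P0 \<Longrightarrow> dist z w \<le> d"
    and N: "(N::nat) \<ge> 1"
  shows "reach P s t (d * (10 + 8 * real N + 8 * real h / real N))"
proof -
  \<comment> \<open>One minimizer per slope is fixed once and for all, so the exceptional heights
    telescope exactly even where minimizers are not unique.\<close>
  define A where "A k i = (SOME a. minimizes_on (tilt 1 (real k / N)) (H i) a)" for k i
  have A: "minimizes_on (tilt 1 (real k / N)) (H i) (A k i)" if "i \<in> {1..h}" for k i
    unfolding A_def using ex_minimizes_on[OF hole_props(3,4)[OF that] continuous_on_tilt] by (rule someI_ex)
  have "\<exists>f. side_function 1 (H i) f" if "i \<in> {1..h}" for i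
    using ex_side_function[OF _ hole_props(1)[OF that]] by auto
  then obtain f where f: "side_function 1 (H i) (f i)" if "i \<in> {1..h}" for i by metis
  obtain r where r: "side_function (-1) P0 r"
    using ex_side_function[of "-1" P0] outer by (auto simp: convex_polygon_def)
  have "\<exists>E. \<forall>i\<in>{1..h}. \<forall>b. E i b \<in> H i \<and> E i b = bd_point 1 (f i) (E i b $ 2) \<and>
           (\<forall>z\<in>H i. E i False $ 2 \<le> z $ 2 \<and> z $ 2 \<le> E i True $ 2)"
    by (rule bchoice) (use ex_extremal_heights f in blast)
  then obtain E where E: "\<forall>i\<in>{1..h}. \<forall>b. E i b \<in> H i \<and> E i b = bd_point 1 (f i) (E i b $ 2) \<and>
           (\<forall>z\<in>H i. E i False $ 2 \<le> z $ 2 \<and> z $ 2 \<le> E i True $ 2)" by blast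
  have d2: "a $ 2 - b $ 2 \<le> d" if "a \<in> H i" "b \<in> H i" "i \<in> {1..h}" for a b i
  proof -
    have "dist a b \<le> d" using d that hole_inside interior_subset by (meson subsetD)
    then show ?thesis using coord_diff_le[of a 2 b] by auto
  qed
  define W where "W k = (\<Sum>i\<in>{1..h}. A (k + 2) i $ 2 - A k i $ 2)" for k
  have AH: "A k i \<in> H i" if "i \<in> {1..h}" for k i using A[OF that] by (auto simp: minimizes_on_def)
  have "sum W {..<N} = (\<Sum>i\<in>{1..h}. \<Sum>k<N. A (k + 2) i $ 2 - A k i $ 2)"
    unfolding W_def by (rule sum.swap)
  also have "\<dots> = (\<Sum>i\<in>{1..h}. A (N + 1) i $ 2 + A N i $ 2 - A 1 i $ 2 - A 0 i $ 2)"
    using telescope_two_steps[of "\<lambda>k. A k i $ 2" N for i] by (intro sum.cong) auto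
  \<comment> \<open>The four surviving terms of a hole pair up into two height differences, each at
    most the diameter.\<close>
  also have "\<dots> \<le> (\<Sum>i\<in>{1..h}. 2 * d)"
  proof (rule sum_mono)
    fix i assume i: "i \<in> {1..h}"
    show "A (N + 1) i $ 2 + A N i $ 2 - A 1 i $ 2 - A 0 i $ 2 \<le> 2 * d"
      using d2[OF AH[OF i, of "N+1"] AH[OF i, of 1] i] d2[OF AH[OF i, of N] AH[OF i, of 0] i] by linarith
  qed
  finally have sW: "sum W {..<N} \<le> 2 * h * d" by simp
  have "\<exists>k<N. W k \<le> 2 * h * d / N"
  proof (rule ccontr)
    assume "\<not> ?thesis"
    then have "(\<Sum>k<N. 2 * h * d / N) < sum W {..<N}"
      using N by (intro sum_strict_mono) (auto simp: not_le lessThan_empty_iff)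
    then show False using sW N by simp
  qed
  then obtain k where k: "k < N" "W k \<le> 2 * h * d / N" by blast
  interpret walk P0 H h P "real (k + 1) / N" "1 / real N" "A (k + 1)" "A (k + 2)" "A k" f r E
  proof
    show "\<bar>real (k + 1) / N\<bar> \<le> 1" using k N by simp
    show "0 < 1 / real N" using N by simp
    show "minimizes_on (tilt 1 (real (k + 1) / N)) (H i) (A (k + 1) i)" if "i \<in> {1..h}" for i
      using A[OF that] .
    have "real (k + 1) / N + 1 / N = real (k + 2) / N" by (simp add: add_divide_distrib[symmetric])
    then show "minimizes_on (tilt 1 (real (k + 1) / N + 1 / N)) (H i) (A (k + 2) i)" if "i \<in> {1..h}" for i
      using A[OF that, of "k+2"] by simp
    have "real (k + 1) / N - 1 / N = real k / N" by (simp add: diff_divide_distrib[symmetric])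
    then show "minimizes_on (tilt 1 (real (k + 1) / N - 1 / N)) (H i) (A k i)" if "i \<in> {1..h}" for i
      using A[OF that, of k] by simp
  qed (use f r E in auto)
  have "reach P s t (10 * d + 8 * d / (1 / N) + 4 * (2 * h * d / N))"
    by (rule reach_walk[OF s t d]) (use k in \<open>auto simp: W_def\<close>)
  then show ?thesis by (rule reach_mono) (simp add: algebra_simps)
qed

text \<open>The diameter of \<open>P0\<close> is attained only at its boundary, and boundary points
  of \<open>P0\<close> avoid all holes and so belong to \<open>P\<close>.\<close>

lemma diam2_eq:
  shows "diam2 P = ereal (diameter P0)" "0 < diameter P0"
proof -
  have cpt: "compact P0" and ne: "interior P0 \<noteq> {}" using outer
    by (auto simp: convex_polygon_def polytope_imp_compact)
  have bd: "bounded P0" using cpt by (rule compact_imp_bounded)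
  obtain q where "q \<in> interior P0" using ne by blast
  then obtain a b where "a \<in> P0" "b \<in> P0" "a \<noteq> b"
    using interior_vertical_room(1)[of q P0] interior_subset[of P0] by force
  then show pos: "0 < diameter P0"
    using diameter_bounded_bound[OF bd, of a b] by (meson dist_pos_lt less_le_trans)
  obtain x y where xy: "x \<in> P0" "y \<in> P0" "dist x y = diameter P0"
    using diameter_compact_attained[OF cpt] interior_subset[of P0] ne by blast
  have frontier: "x \<notin> interior P0" if xy: "x \<in> P0" "y \<in> P0" "dist x y = diameter P0" for x y
  proof
    assume "x \<in> interior P0"
    then obtain e where e: "e > 0" "ball x e \<subseteq> P0" by (auto simp: mem_interior)
    have ne: "x \<noteq> y" using xy(3) pos by auto
    \<comment> \<open>With this factor \<open>w\<close> lies \<open>e / 2\<close> beyond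
      \<open>x\<close> as seen from \<open>y\<close>: still in \<open>P0\<close>, but farther away
      than the diameter allows.\<close>
    define k where "k = e / 2 / dist x y"
    have k: "k > 0" "k * norm (x - y) = e / 2" using e ne by (auto simp: k_def dist_norm)
    define w where "w = x + k *\<^sub>R (x - y)"
    have "dist x w = k * norm (x - y)" unfolding w_def dist_norm using k(1) by simp
    then have "dist w y \<le> diameter P0"
      using e xy(2) k(2) by (intro diameter_bounded_bound[OF bd]) auto
    moreover have "w - y = (1 + k) *\<^sub>R (x - y)"
      by (simp add: w_def scaleR_add_left)
    then have "dist w y = (1 + k) * norm (x - y)"
      unfolding dist_norm using k(1) by simp
    then have "dist w y = dist x y + e / 2"
      unfolding distrib_right k(2) by (simp add: dist_norm)
    ultimately show False using xy(3) e(1) by simp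
  qed
  have "x \<in> P" "y \<in> P"
    using frontier[OF xy] frontier[of y x] xy by (auto intro!: outer_boundary_in simp: dist_commute)
  then have "ereal (diameter P0) \<le> diam2 P"
    unfolding diam2_def xy(3)[symmetric] by (intro SUP_upper2[of x] SUP_upper2[of y]) auto
  moreover have "diam2 P \<le> ereal (diameter P0)"
    unfolding diam2_def using diameter_bounded_bound[OF bd] by (auto intro!: SUP_least simp: P_eq)
  ultimately show "diam2 P = ereal (diameter P0)" by (rule antisym[rotated])
qed

lemma distortion_le:
  assumes "h \<ge> 1"
  shows "distortion P \<le> ereal (34 * sqrt h)"
proof -
  define d where "d = diameter P0"
  have d: "dist z w \<le> d" if "z \<in> P0" "w \<in> P0" for z w
    unfolding d_def using outer that
    by (intro diameter_bounded_bound) (auto simp: convex_polygon_def polytope_imp_bounded)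
  have dpos: "d > 0" using diam2_eq(2) by (simp add: d_def)
  \<comment> \<open>This balances \<open>8 * N\<close> against \<open>8 * h / N\<close>. With
    \<open>1 \<le> sqrt h\<close> and \<open>N \<le> 2 * sqrt h\<close> the three terms add up to 10
    + 16 + 8 = 34 times \<open>sqrt h\<close>.\<close>
  define N where "N = nat \<lceil>sqrt h\<rceil>"
  have sq: "1 \<le> sqrt h" using assms by simp
  then have N: "N \<ge> 1" "sqrt h \<le> N" "N \<le> sqrt h + 1" unfolding N_def by linarith+
  have "real h = sqrt h * sqrt h" by simp
  also have "\<dots> \<le> sqrt h * N" using N by (intro mult_left_mono) auto
  finally have "h / N \<le> sqrt h" using N(1) by (simp add: divide_le_eq)
  then have le: "10 + 8 * real N + 8 * real h / real N \<le> 34 * sqrt h"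
    unfolding times_divide_eq_right[symmetric] using N sq by linarith
  have "geod P s t \<le> 34 * sqrt h * d" if "s \<in> P" "t \<in> P" for s t
  proof -
    have "geod P s t \<le> d * (10 + 8 * real N + 8 * real h / real N)"
      by (rule geod_le[OF reach_all[OF that d N(1)]])
    also have "\<dots> \<le> d * (34 * sqrt h)" using le dpos by (intro mult_left_mono) auto
    finally show ?thesis by (simp add: mult.commute)
  qed
  then have "diamg P \<le> ereal (34 * sqrt h * d)"
    unfolding diamg_def by (auto intro!: SUP_least)
  then have "distortion P \<le> ereal (34 * sqrt h * d) / ereal d"
    unfolding distortion_def diam2_eq(1) d_def[symmetric] using dpos by (intro ereal_divide_right_mono) auto
  then show ?thesis using dpos by simp
qed

end

lemma domains_holed_polygon:
  assumes "P \<in> domains h"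
  obtains P0 H where "holed_polygon P0 H h P"
  using assms unfolding domains_def holed_polygon_def by blast

lemma g_upper:
  assumes "h \<ge> 1"
  shows "g h \<le> ereal (34 * sqrt h)"
  unfolding g_def
proof (rule SUP_least)
  fix P assume "P \<in> domains h"
  then obtain P0 H where "holed_polygon P0 H h P" by (rule domains_holed_polygon)
  then show "distortion P \<le> ereal (34 * sqrt h)"
    using assms by (rule holed_polygon.distortion_le)
qed

section \<open>Long paths around thickened segments\<close>

text \<open>The intermediate value theorem applies on the first segment whose end has
  \<open>F\<close> at least \<open>r\<close>. The rest of the path is again polygonal, so the cut
  can be repeated at the next level. The start is put into \<open>P\<close> explicitly because a
  one-point path has no segments.\<close>

lemma polygonal_path_crossing:
  fixes F :: "pt \<Rightarrow> real"
  assumes "polygonal_path_in P s t ps" "s \<in> P" "continuous_on UNIV F" "F s \<le> r" "r \<le> F t"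
  shows "\<exists>z qs. z \<in> P \<and> F z = r \<and> polygonal_path_in P z t qs \<and> dist s z + path_len qs \<le> path_len ps"
  using assms
proof (induction ps arbitrary: s rule: induct_list012)
  case 1
  then show ?case by (simp add: polygonal_path_in_def)
next
  case (2 x)
  then show ?case
    by (intro exI[of _ s] exI[of _ "[s]"]) (auto simp: polygonal_path_in_single path_len_def)
next
  case (3 x y zs)
  then have xy: "closed_segment x y \<subseteq> P" and tail: "polygonal_path_in P y t (y # zs)" and "x = s"
    by (auto simp: polygonal_path_in_Cons_Cons)
  show ?case
  proof (cases "r \<le> F y")
    case True
    have "connected (F ` closed_segment x y)"
      using 3 by (intro connected_continuous_image) (auto intro: continuous_on_subset)
    then have "r \<in> F ` closed_segment x y"
      using connectedD_interval[of "F ` closed_segment x y" "F x" "F y" r] True 3 \<open>x = s\<close> by auto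
    then obtain z where z: "z \<in> closed_segment x y" "F z = r" by auto
    have "closed_segment z y \<subseteq> P"
      using z(1) xy subset_closed_segment[of z y x y] by auto
    moreover have "dist x y = dist x z + dist z y"
      using z(1) by (simp add: between_mem_segment[symmetric] between)
    ultimately show ?thesis
      using z xy tail \<open>x = s\<close>
      by (intro exI[of _ z] exI[of _ "z # y # zs"])
        (auto simp: polygonal_path_in_Cons_Cons path_len_Cons_Cons)
  next
    case False
    moreover have "y \<in> P" using xy by auto
    ultimately obtain z qs where "z \<in> P" "F z = r" "polygonal_path_in P z t qs"
      "dist y z + path_len qs \<le> path_len (y # zs)"
      using "3.IH"(2)[OF tail] 3 by force
    then show ?thesis
      using dist_triangle[of x z y] \<open>x = s\<close>
      by (intro exI[of _ z] exI[of _ qs]) (auto simp: path_len_Cons_Cons)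
  qed
qed

section \<open>Thickening segments to disjoint convex holes\<close>

definition thicken :: "pt set \<Rightarrow> real \<Rightarrow> pt set" where
  "thicken S \<delta> = S + cbox (vector [-\<delta>, -\<delta>]) (vector [\<delta>, \<delta>])"

lemma mem_cbox_pt: "(x::pt) \<in> cbox a b \<longleftrightarrow> a $ 1 \<le> x $ 1 \<and> x $ 1 \<le> b $ 1 \<and> a $ 2 \<le> x $ 2 \<and> x $ 2 \<le> b $ 2"
  by (auto simp: mem_box_cart forall_2)

lemma mem_box_pt: "(x::pt) \<in> box a b \<longleftrightarrow> a $ 1 < x $ 1 \<and> x $ 1 < b $ 1 \<and> a $ 2 < x $ 2 \<and> x $ 2 < b $ 2"
  by (auto simp: mem_box_cart forall_2)

lemma subset_interior_thicken:
  assumes "\<delta> > 0"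
  shows "S \<subseteq> interior (thicken S \<delta>)"
proof
  fix s assume s: "s \<in> S"
  let ?B = "(+) s ` box (vector [-\<delta>, -\<delta>]) (vector [\<delta>, \<delta>] :: pt)"
  have "open ?B" by (intro open_translation open_box)
  moreover have "s \<in> ?B" using assms by (intro image_eqI[of _ _ 0]) (auto simp: mem_box_pt)
  moreover have "?B \<subseteq> thicken S \<delta>" unfolding thicken_def
    using s box_subset_cbox by (blast intro: set_plus_intro)
  ultimately show "s \<in> interior (thicken S \<delta>)" by (rule interiorI)
qed

lemma thicken_near:
  assumes "x \<in> thicken S \<delta>"
  shows "\<exists>s\<in>S. dist s x \<le> 2 * \<delta>"
proof -
  obtain s y where sy: "s \<in> S" "y \<in> cbox (vector [-\<delta>, -\<delta>]) (vector [\<delta>, \<delta>] :: pt)" "x = s + y"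
    using assms by (auto simp: thicken_def elim: set_plus_elim)
  have "dist s x \<le> \<bar>y $ 1\<bar> + \<bar>y $ 2\<bar>" using dist_pt_le[of s x] sy(3) by simp
  then show ?thesis using sy(1,2) by (intro bexI[of _ s]) (auto simp: mem_cbox_pt)
qed

text \<open>Thickening by a square instead of a disc keeps the set a polytope: both summands are
  hulls of finite sets, and hulls commute with Minkowski sums.\<close>

lemma convex_polygon_thicken_segment:
  assumes "\<delta> > 0"
  shows "convex_polygon (thicken (closed_segment a b) \<delta>)"
proof -
  let ?C = "cbox (vector [-\<delta>, -\<delta>]) (vector [\<delta>, \<delta>] :: pt)"
  obtain V where V: "finite V" "?C = convex hull V"
    using polytope_interval[of "vector [-\<delta>, -\<delta>]" "vector [\<delta>, \<delta>] :: pt"] unfolding polytope_def by blast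
  have "thicken (closed_segment a b) \<delta> = convex hull ({a, b} + V)"
    unfolding thicken_def V(2) by (simp add: convex_hull_set_plus segment_convex_hull)
  then have "polytope (thicken (closed_segment a b) \<delta>)"
    using V(1) by (simp add: polytope_convex_hull finite_set_plus)
  then show ?thesis
    using subset_interior_thicken[OF assms, of "closed_segment a b"] by (auto simp: convex_polygon_def)
qed

text \<open>Disjoint compact sets have positive distance, so each of the finitely many conditions
  holds for all small \<open>\<delta>\<close>. Thickening moves points by at most
  \<open>2 * \<delta>\<close>, which explains the thresholds \<open>d / 2\<close> for one thickened
  set and \<open>d / 4\<close> for two.\<close>

lemma segments_in_disjoint_polygons:
  fixes S :: "'i \<Rightarrow> pt set"
  assumes I: "finite I" and seg: "\<And>i. i \<in> I \<Longrightarrow> \<exists>a b. S i = closed_segment a b"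
    and disj: "\<And>i j. i \<in> I \<Longrightarrow> j \<in> I \<Longrightarrow> i \<noteq> j \<Longrightarrow> S i \<inter> S j = {}"
    and U: "open U" "\<And>i. i \<in> I \<Longrightarrow> S i \<subseteq> U"
  shows "\<exists>K. (\<forall>i\<in>I. convex_polygon (K i) \<and> S i \<subseteq> interior (K i) \<and> K i \<subseteq> U) \<and>
             (\<forall>i\<in>I. \<forall>j\<in>I. i \<noteq> j \<longrightarrow> K i \<inter> K j = {})"
proof -
  have cpt: "compact (S i)" if "i \<in> I" for i using seg[OF that] by auto
  have sub: "\<forall>\<^sub>F \<delta> in at_right 0. thicken (S i) \<delta> \<subseteq> U" if i: "i \<in> I" for i
  proof -
    have "S i \<inter> - U = {}" "closed (- U)" using U i by auto
    then obtain d where d: "d > 0" "\<And>x y. x \<in> S i \<Longrightarrow> y \<in> - U \<Longrightarrow> d \<le> dist x y"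
      using separate_compact_closed[OF cpt[OF i]] by metis
    have "thicken (S i) \<delta> \<subseteq> U" if "\<delta> < d / 2" for \<delta>
      using thicken_near[of _ "S i" \<delta>] d(2) that by (force simp: subset_iff)
    then show ?thesis using d(1)
      unfolding eventually_at_right_field by (intro exI[of _ "d / 2"]) simp
  qed
  have dis: "\<forall>\<^sub>F \<delta> in at_right 0. i \<noteq> j \<longrightarrow> thicken (S i) \<delta> \<inter> thicken (S j) \<delta> = {}"
    if ij: "i \<in> I" "j \<in> I" for i j
  proof (cases "i = j")
    case False
    obtain d where d: "d > 0" "\<And>x y. x \<in> S i \<Longrightarrow> y \<in> S j \<Longrightarrow> d \<le> dist x y"
      using separate_compact_closed[OF cpt[OF ij(1)] compact_imp_closed[OF cpt[OF ij(2)]]]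
        disj[OF ij False] by metis
    have "thicken (S i) \<delta> \<inter> thicken (S j) \<delta> = {}" if "\<delta> < d / 4" for \<delta>
    proof -
      have False if x: "x \<in> thicken (S i) \<delta>" "x \<in> thicken (S j) \<delta>" for x
      proof -
        obtain s t where st: "s \<in> S i" "dist s x \<le> 2 * \<delta>" "t \<in> S j" "dist t x \<le> 2 * \<delta>"
          using thicken_near x by metis
        have "d \<le> dist s t" using d(2) st by blast
        then show False
          using dist_triangle2[of s t x] st(2,4) \<open>\<delta> < d / 4\<close> by linarith
      qed
      then show ?thesis by blast
    qed
    then show ?thesis using d(1)
      unfolding eventually_at_right_field by (intro exI[of _ "d / 4"]) simp
  qed auto
  have "\<forall>\<^sub>F \<delta> in at_right (0::real). \<delta> > 0" by (rule eventually_at_right_less)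
  moreover have "\<forall>\<^sub>F \<delta> in at_right 0. \<forall>i\<in>I. thicken (S i) \<delta> \<subseteq> U"
    using I sub by (intro eventually_ball_finite) auto
  moreover have "\<forall>\<^sub>F \<delta> in at_right 0. \<forall>i\<in>I. \<forall>j\<in>I. i \<noteq> j \<longrightarrow> thicken (S i) \<delta> \<inter> thicken (S j) \<delta> = {}"
    using I dis by (intro eventually_ball_finite ballI) auto
  ultimately have "\<forall>\<^sub>F \<delta> in at_right 0. \<delta> > 0 \<and> (\<forall>i\<in>I. thicken (S i) \<delta> \<subseteq> U) \<and>
      (\<forall>i\<in>I. \<forall>j\<in>I. i \<noteq> j \<longrightarrow> thicken (S i) \<delta> \<inter> thicken (S j) \<delta> = {})"
    by eventually_elim auto
  then have "\<exists>\<delta>. \<delta> > 0 \<and> (\<forall>i\<in>I. thicken (S i) \<delta> \<subseteq> U) \<and>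
      (\<forall>i\<in>I. \<forall>j\<in>I. i \<noteq> j \<longrightarrow> thicken (S i) \<delta> \<inter> thicken (S j) \<delta> = {})"
    by (rule eventually_happens'[OF trivial_limit_at_right_real])
  then obtain \<delta> where \<delta>: "\<delta> > 0" "\<forall>i\<in>I. thicken (S i) \<delta> \<subseteq> U"
    "\<forall>i\<in>I. \<forall>j\<in>I. i \<noteq> j \<longrightarrow> thicken (S i) \<delta> \<inter> thicken (S j) \<delta> = {}"
    by (elim exE conjE)
  have "convex_polygon (thicken (S i) \<delta>)" if "i \<in> I" for i
    using seg[OF that] convex_polygon_thicken_segment[OF \<delta>(1)] by auto
  then show ?thesis
    using \<delta>(2,3) subset_interior_thicken[OF \<delta>(1)]
    by (intro exI[of _ "\<lambda>i. thicken (S i) \<delta>"]) simp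
qed

text \<open>Segments may serve as obstacles, since each sits in the interior of a thin hole.
  Removing \<open>s\<close> and \<open>t\<close> from the region for the holes keeps both in the
  domain. The 20 bounds the diameter of the box, by the sum of its side lengths.\<close>

lemma g_lower_from_segments:
  fixes S :: "nat \<Rightarrow> pt set"
  assumes h: "h \<ge> 1"
    and seg: "\<And>i. i \<in> {1..h} \<Longrightarrow> \<exists>a b. S i = closed_segment a b"
    and disj: "\<And>i j. i \<in> {1..h} \<Longrightarrow> j \<in> {1..h} \<Longrightarrow> i \<noteq> j \<Longrightarrow> S i \<inter> S j = {}"
    and S: "\<And>i. i \<in> {1..h} \<Longrightarrow> S i \<subseteq> box (vector [-5, -5]) (vector [5, 5]) - {s, t}"
    and st: "s \<in> box (vector [-5, -5]) (vector [5, 5])" "t \<in> box (vector [-5, -5]) (vector [5, 5])"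
    and long: "\<And>P ps. polygonal_path_in P s t ps \<Longrightarrow> s \<in> P \<Longrightarrow> (\<And>i. i \<in> {1..h} \<Longrightarrow> S i \<inter> P = {}) \<Longrightarrow> l \<le> path_len ps"
    and "0 \<le> l"
  shows "ereal (l / 20) \<le> g h"
proof -
  define P0 :: "pt set" where "P0 = cbox (vector [-5, -5]) (vector [5, 5])"
  have int: "interior P0 = box (vector [-5, -5]) (vector [5, 5])"
    by (simp add: P0_def interior_cbox)
  have "open (interior P0 - {s, t})" by (simp add: open_Diff)
  moreover have "\<And>i. i \<in> {1..h} \<Longrightarrow> S i \<subseteq> interior P0 - {s, t}" using S unfolding int .
  ultimately have "\<exists>K. (\<forall>i\<in>{1..h}. convex_polygon (K i) \<and> S i \<subseteq> interior (K i) \<and> K i \<subseteq> interior P0 - {s, t}) \<and>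
             (\<forall>i\<in>{1..h}. \<forall>j\<in>{1..h}. i \<noteq> j \<longrightarrow> K i \<inter> K j = {})"
    using seg disj by (intro segments_in_disjoint_polygons) blast+
  then obtain K where K': "\<forall>i\<in>{1..h}. convex_polygon (K i) \<and> S i \<subseteq> interior (K i) \<and> K i \<subseteq> interior P0 - {s, t}"
      "\<forall>i\<in>{1..h}. \<forall>j\<in>{1..h}. i \<noteq> j \<longrightarrow> K i \<inter> K j = {}"
    by blast
  then have K: "\<And>i. i \<in> {1..h} \<Longrightarrow> convex_polygon (K i)"
      "\<And>i. i \<in> {1..h} \<Longrightarrow> S i \<subseteq> interior (K i)" "\<And>i. i \<in> {1..h} \<Longrightarrow> K i \<subseteq> interior P0 - {s, t}"
      "\<And>i j. i \<in> {1..h} \<Longrightarrow> j \<in> {1..h} \<Longrightarrow> i \<noteq> j \<Longrightarrow> K i \<inter> K j = {}"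
    by blast+
  define P where "P = P0 - (\<Union>i\<in>{1..h}. interior (K i))"
  have outer: "convex_polygon P0"
    using st unfolding convex_polygon_def int P0_def by (auto simp: polytope_interval)
  interpret holed_polygon P0 K h P
    by (rule holed_polygon.intro[OF outer K(1) _ K(4) P_def]) (use K(3) in blast)+
  have dom: "P \<in> domains h"
    unfolding domains_def using K' outer P_def by blast
  have sP: "s \<in> P" and tP: "t \<in> P"
    using st K(3) interior_subset[of P0] interior_subset[of "K i" for i] unfolding P_def int by fastforce+
  \<comment> \<open>The upper bound with \<open>N = 1\<close> provides some path from
    \<open>s\<close> to \<open>t\<close>, so that \<open>geod\<close> is an infimum over a nonempty
    set.\<close>
  obtain d where d: "reach P s t d"
    using reach_all[OF sP tP _ order_refl, of "diameter P0"] outer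
    by (auto simp: convex_polygon_def polytope_imp_bounded diameter_bounded_bound)
  have avoid: "S i \<inter> P = {}" if "i \<in> {1..h}" for i
    using K(2)[OF that] that unfolding P_def by blast
  have "l \<le> geod P s t"
    by (rule geod_ge[OF d long[OF _ sP avoid]])
  then have "ereal l \<le> diamg P"
    unfolding diamg_def by (intro SUP_upper2[OF sP] SUP_upper2[OF tP]) auto
  then have "ereal l / ereal (diameter P0) \<le> distortion P"
    unfolding distortion_def diam2_eq(1) using diam2_eq(2) by (intro ereal_divide_right_mono) auto
  moreover have "diameter P0 \<le> 20"
  proof (rule diameter_le)
    fix x y assume "x \<in> P0" "y \<in> P0"
    then show "norm (x - y) \<le> 20"
      using dist_pt_le[of x y] unfolding P0_def mem_cbox_pt dist_norm by auto
  qed (use outer interior_subset[of P0] in \<open>auto simp: convex_polygon_def\<close>)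
  then have "l / 20 \<le> l / diameter P0"
    using diam2_eq(2) \<open>0 \<le> l\<close> by (intro divide_left_mono) auto
  ultimately have "ereal (l / 20) \<le> distortion P"
    using diam2_eq(2) by (metis ereal_divide ereal_less_eq(3) less_numeral_extra(3) order_trans)
  then show ?thesis unfolding g_def using dom by (rule SUP_upper2[rotated])
qed

section \<open>Concentric rings of sticks\<close>

definition dir :: "real \<Rightarrow> pt" where
  "dir \<theta> = vector [cos \<theta>, sin \<theta>]"

definition perp :: "real \<Rightarrow> pt" where
  "perp \<theta> = vector [- sin \<theta>, cos \<theta>]"

lemma dir_nth [simp]: "dir \<theta> $ 1 = cos \<theta>" "dir \<theta> $ 2 = sin \<theta>"
  and perp_nth [simp]: "perp \<theta> $ 1 = - sin \<theta>" "perp \<theta> $ 2 = cos \<theta>"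
  by (simp_all add: dir_def perp_def)

lemma dir_inner: "dir \<theta> \<bullet> dir \<phi> = cos (\<phi> - \<theta>)" "perp \<theta> \<bullet> dir \<phi> = sin (\<phi> - \<theta>)"
  "dir \<theta> \<bullet> perp \<theta> = 0" "perp \<theta> \<bullet> perp \<theta> = 1"
  by (simp_all add: inner_pt cos_diff sin_diff algebra_simps flip: power2_eq_square)

lemma norm_dir [simp]: "norm (dir \<theta>) = 1" "norm (perp \<theta>) = 1"
  by (simp_all add: norm_eq_sqrt_inner dir_inner)

lemma frame_expansion: "z = (z \<bullet> dir \<theta>) *\<^sub>R dir \<theta> + (z \<bullet> perp \<theta>) *\<^sub>R perp \<theta>"
proof -
  have *: "cos \<theta> * (cos \<theta> * a) + sin \<theta> * (sin \<theta> * a) = a" for a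
  proof -
    have "cos \<theta> * (cos \<theta> * a) + sin \<theta> * (sin \<theta> * a) = ((cos \<theta>)\<^sup>2 + (sin \<theta>)\<^sup>2) * a"
      by (simp only: power2_eq_square distrib_right mult.assoc)
    then show ?thesis by simp
  qed
  show ?thesis by (simp add: pt_eq_iff inner_pt algebra_simps *)
qed

lemma inner_dir_frame:
  "z \<bullet> dir \<phi> = (z \<bullet> dir \<theta>) * cos (\<phi> - \<theta>) + (z \<bullet> perp \<theta>) * sin (\<phi> - \<theta>)"
  by (subst frame_expansion[of z \<theta>]) (simp add: inner_add_left dir_inner)

lemma norm_frame: "(norm z)\<^sup>2 = (z \<bullet> dir \<theta>)\<^sup>2 + (z \<bullet> perp \<theta>)\<^sup>2"
  unfolding power2_norm_eq_inner
  by (subst (1 2) frame_expansion[of z \<theta>])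
    (simp add: inner_add_left inner_add_right dir_inner inner_commute[of "perp \<theta>" "dir \<theta>"] power2_eq_square)

lemma dir_plus_period: "dir (\<theta> + 2 * pi * of_int n) = dir \<theta>"
  by (simp add: pt_eq_iff cos_add sin_add)

lemma continuous_on_Max_image:
  fixes f :: "'i \<Rightarrow> 'a::topological_space \<Rightarrow> real"
  assumes "finite A" "A \<noteq> {}" "\<And>a. a \<in> A \<Longrightarrow> continuous_on S (f a)"
  shows "continuous_on S (\<lambda>x. Max ((\<lambda>a. f a x) ` A))"
  using assms by (induction A rule: finite_ne_induct) (auto intro!: continuous_intros)

text \<open>Reduction modulo \<open>2 * k\<close> preserves oddness, so the residue is not 0;
  reflection then moves it into \<open>1..k\<close>, where the cosine decreases. The vertex
  directions of consecutive rings differ by such odd multiples.\<close>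

lemma cos_odd_multiple_le:
  assumes "odd m" "k \<ge> 1"
  shows "cos (of_int m * (pi / real k)) \<le> cos (pi / k)"
proof -
  define n where "n = m mod (2 * int k)"
  have m: "m = n + (2 * int k) * (m div (2 * int k))" by (simp add: n_def)
  have "even ((2 * int k) * (m div (2 * int k)))" by simp
  then have "odd n" using m assms(1) by (metis even_add)
  then have n: "0 \<le> n" "n < 2 * int k" "odd n"
    using assms(2) by (auto simp: n_def)
  have b: "of_int n * (pi / k) = 2 * pi - of_int (2 * int k - n) * (pi / k)"
    using assms by (simp add: field_simps)
  have "of_int m * (pi / k) = of_int n * (pi / k) + 2 * pi * of_int (m div (2 * int k))"
    using assms by (subst m) (simp add: field_simps)
  then have eq: "cos (of_int m * (pi / k)) = cos (of_int n * (pi / k))"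
    by (simp add: cos_add)
  have le: "cos (of_int j * (pi / k)) \<le> cos (pi / k)" if "1 \<le> j" "j \<le> int k" for j
  proof (rule cos_monotone_0_pi_le)
    show "pi / k \<le> of_int j * (pi / k)" using that assms by (simp add: field_simps)
    have "of_int j * (pi / k) \<le> of_int (int k) * (pi / k)" using that by (intro mult_right_mono) auto
    then show "of_int j * (pi / k) \<le> pi" using assms by simp
  qed simp
  show ?thesis
  proof (cases "n \<le> int k")
    case True
    moreover have "1 \<le> n" using n by presburger
    ultimately show ?thesis using le eq by simp
  next
    case False
    have "cos (of_int n * (pi / k)) = cos (of_int (2 * int k - n) * (pi / k))"
      unfolding b by (simp only: cos_2pi_minus)
    moreover have "1 \<le> 2 * int k - n" "2 * int k - n \<le> int k" using n False by auto
    ultimately show ?thesis using le[of "2 * int k - n"] eq by simp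
  qed
qed

text \<open>The condition \<open>20 n \<le> k\<^sup>2\<close> makes room for \<open>n\<close> nested \<open>k\<close>-gons with inradii in \<open>[1, 2)\<close>.\<close>
locale rings =
  fixes n k :: nat
  assumes n: "n \<ge> 1" and k: "k \<ge> 4" and nk: "20 * n \<le> k\<^sup>2"
begin

definition \<beta> :: real where "\<beta> = pi / k"

text \<open>Angle of the outward normal of edge \<open>j\<close>; \<open>\<beta>\<close> is half the
  angle between adjacent normals, so odd rings are rotated by half a step.\<close>

definition normal :: "nat \<Rightarrow> int \<Rightarrow> real" where
  "normal i j = of_int (2 * j + int (i mod 2)) * \<beta>"

definition radius :: "nat \<Rightarrow> real" where "radius i = 1 + i / n"

text \<open>An edge has half-length \<open>radius i * tan \<beta>\<close>; keeping 7/8 of it leaves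
  a short gap at each vertex.\<close>

definition stick :: "nat \<Rightarrow> nat \<Rightarrow> pt set" where
  "stick i j = (let \<theta> = normal i (int j); \<tau> = 7 / 8 * (radius i * tan \<beta>) in
     closed_segment (radius i *\<^sub>R dir \<theta> - \<tau> *\<^sub>R perp \<theta>) (radius i *\<^sub>R dir \<theta> + \<tau> *\<^sub>R perp \<theta>))"

text \<open>The \<open>i\<close>-th polygon is the sublevel set of \<open>gauge i\<close> at
  \<open>radius i\<close>, and its boundary is the level set, ready for crossing arguments.\<close>

definition gauge :: "nat \<Rightarrow> pt \<Rightarrow> real" where
  "gauge i z = Max ((\<lambda>j. z \<bullet> dir (normal i (int j))) ` {..<k})"

lemma \<beta>: "0 < \<beta>" "\<beta> \<le> pi / 4" "\<beta> < 1" "k * \<beta> = pi"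
proof -
  show "0 < \<beta>" "\<beta> \<le> pi / 4" "k * \<beta> = pi"
    using k by (auto simp: \<beta>_def field_simps)
  then show "\<beta> < 1" using pi_less_4 by linarith
qed

lemma trig: "sin \<beta> > 0" "cos \<beta> > 1 / 2" "cos \<beta> * tan \<beta> = sin \<beta>" "tan \<beta> > 0"
proof -
  show "sin \<beta> > 0" using \<beta> pi_gt_zero by (intro sin_gt_zero) linarith+
  have "cos (pi / 3) < cos \<beta>" using \<beta> pi_gt_zero by (intro cos_monotone_0_pi) linarith+
  then show c: "cos \<beta> > 1 / 2" by (simp add: cos_60)
  then show "cos \<beta> * tan \<beta> = sin \<beta>" by (simp add: tan_def)
  show "tan \<beta> > 0" using c \<open>sin \<beta> > 0\<close> by (simp add: tan_def)
qed

lemma radius: "1 \<le> radius i" "radius (Suc i) = radius i + 1 / n" "i < n \<Longrightarrow> radius i < 2"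
  "i \<le> i' \<Longrightarrow> radius i \<le> radius i'" "i \<le> n \<Longrightarrow> radius i \<le> 2"
  using n by (auto simp: radius_def field_simps)

text \<open>From \<open>pi\<^sup>2 < 10\<close> and \<open>20 * n \<le> k\<^sup>2\<close> follows
  \<open>\<beta>\<^sup>2 < 1 / (2 * n)\<close>, so the defect
  \<open>radius (Suc i) * (1 - cos \<beta>)\<close> is below the step \<open>1 / n\<close>. Hence
  the circumcircle of each polygon lies inside the incircle of the next.\<close>

lemma rings_nested:
  assumes "i < n"
  shows "radius i < radius (Suc i) * cos \<beta>"
proof -
  have "(sin (\<beta> / 2))\<^sup>2 \<le> (\<beta> / 2)\<^sup>2"
    using \<beta>(1,2) pi_gt_zero by (intro power_mono sin_x_le_x sin_ge_zero) linarith+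
  then have "1 - cos \<beta> \<le> \<beta>\<^sup>2 / 2"
    using cos_double_sin[of "\<beta> / 2"] by (simp add: power_divide)
  have "pi\<^sup>2 < 10"
  proof -
    have "pi \<le> 31415926535899 / 10 ^ 13" by (rule pi_approx(2))
    also have "\<dots> < 3.15" by simp
    finally have "pi < 3.15" .
    then have "pi * pi < 3.15 * 3.15" by (intro mult_strict_mono) auto
    then show ?thesis by (simp add: power2_eq_square)
  qed
  moreover have "\<beta>\<^sup>2 * (real k)\<^sup>2 = pi\<^sup>2" using \<beta>(4) by (metis mult.commute power_mult_distrib)
  moreover have "20 * real n \<le> (real k)\<^sup>2" using nk by (metis of_nat_le_iff of_nat_mult of_nat_numeral of_nat_power)
  then have "\<beta>\<^sup>2 * (20 * real n) \<le> \<beta>\<^sup>2 * (real k)\<^sup>2" by (intro mult_left_mono) auto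
  ultimately have "\<beta>\<^sup>2 * n < 1 / 2" by linarith
  then have b: "\<beta>\<^sup>2 < 1 / (2 * n)" using n by (simp add: field_simps)
  have "radius (Suc i) * (1 - cos \<beta>) \<le> 2 * (\<beta>\<^sup>2 / 2)"
    using radius(5)[of "Suc i"] radius(1)[of "Suc i"] assms \<open>1 - cos \<beta> \<le> \<beta>\<^sup>2 / 2\<close> by (intro mult_mono) auto
  also have "\<dots> < 1 / n" using b n by (simp add: field_simps)
  finally show ?thesis using radius(2)[of i] by (simp add: algebra_simps)
qed

text \<open>Edge indices are integers here, reduced modulo \<open>k\<close> by periodicity, so the
  neighbours of an edge can be used without wrap-around cases.\<close>

lemma inner_normal_le_gauge: "z \<bullet> dir (normal i j) \<le> gauge i z"
proof -
  define j' where "j' = nat (j mod int k)"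
  have j': "j' < k" "j = int j' + int k * (j div int k)"
    using k by (auto simp: j'_def nat_less_iff)
  have "normal i j = normal i (int j') + 2 * pi * of_int (j div int k)"
    unfolding normal_def \<beta>(4)[symmetric] by (subst j'(2)) (simp add: algebra_simps)
  then have "dir (normal i j) = dir (normal i (int j'))" by (simp only: dir_plus_period)
  then show ?thesis unfolding gauge_def using j'(1) by (auto intro!: Max_ge)
qed

lemma gauge_attained: "\<exists>j<k. gauge i z = z \<bullet> dir (normal i (int j))"
proof -
  have "gauge i z \<in> (\<lambda>j. z \<bullet> dir (normal i (int j))) ` {..<k}"
    unfolding gauge_def using k by (intro Max_in) (auto simp: lessThan_empty_iff)
  then show ?thesis by auto
qed

lemma continuous_on_gauge: "continuous_on S (gauge i)"
  unfolding gauge_def using k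
  by (intro continuous_on_Max_image) (auto intro!: continuous_intros simp: lessThan_empty_iff)

lemma gauge_le_norm: "gauge i z \<le> norm z"
  using gauge_attained[of i z] norm_cauchy_schwarz[of z "dir \<theta>" for \<theta>] by (metis mult.right_neutral norm_dir(1))

text \<open>Comparison with the two adjacent normals bounds the tangential coordinate by
  \<open>r * (1 - cos (2 * \<beta>)) / sin (2 * \<beta>)\<close>, that is by
  \<open>r * tan \<beta>\<close>, where \<open>r\<close> is \<open>radius i\<close>.\<close>

lemma edge:
  assumes "gauge i z = radius i"
  obtains j where "j < k" "z \<bullet> dir (normal i (int j)) = radius i"
    "\<bar>z \<bullet> perp (normal i (int j))\<bar> \<le> radius i * tan \<beta>"
proof -
  obtain j where j: "j < k" "z \<bullet> dir (normal i (int j)) = radius i"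
    using gauge_attained[of i z] assms by auto
  define q where "q = z \<bullet> perp (normal i (int j))"
  let ?r = "radius i"
  have nb: "normal i (int j + e) - normal i (int j) = of_int e * (2 * \<beta>)" for e
    by (simp add: normal_def algebra_simps)
  have "?r * cos (of_int e * (2 * \<beta>)) + q * sin (of_int e * (2 * \<beta>)) \<le> ?r" for e
    using inner_normal_le_gauge[of z i "int j + e"] inner_dir_frame[of z "normal i (int j + e)" "normal i (int j)"]
    by (simp add: nb j assms q_def)
  from this[of 1] this[of "-1"] have "\<bar>q\<bar> * sin (2 * \<beta>) \<le> ?r * (1 - cos (2 * \<beta>))"
    by (auto simp: abs_if algebra_simps)
  moreover have "1 - cos (2 * \<beta>) = 2 * (sin \<beta> * sin \<beta>)" by (simp add: cos_double_sin power2_eq_square)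
  ultimately have "\<bar>q\<bar> * (2 * sin \<beta> * cos \<beta>) \<le> ?r * (2 * (sin \<beta> * sin \<beta>))"
    by (simp only: sin_double)
  then have "(2 * sin \<beta>) * (\<bar>q\<bar> * cos \<beta>) \<le> (2 * sin \<beta>) * (?r * sin \<beta>)"
    by (simp only: mult_ac)
  then have "\<bar>q\<bar> * cos \<beta> \<le> ?r * sin \<beta>" using trig(1) by (simp only: mult_le_cancel_left_pos)
  then have "\<bar>q\<bar> \<le> ?r * tan \<beta>" using trig(2) by (simp add: tan_def field_simps)
  then show thesis using that j by (auto simp: q_def)
qed

section \<open>Position and disjointness of the sticks\<close>

lemma norm_edge_le:
  assumes "z \<bullet> dir \<theta> = r" "\<bar>z \<bullet> perp \<theta>\<bar> \<le> r * tan \<beta>" "0 \<le> r"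
  shows "norm z * cos \<beta> \<le> r"
proof -
  have "(z \<bullet> perp \<theta>)\<^sup>2 \<le> (r * tan \<beta>)\<^sup>2" using assms(2) by (metis abs_ge_zero power2_abs power_mono)
  then have "(norm z)\<^sup>2 \<le> r\<^sup>2 + (r * tan \<beta>)\<^sup>2" using norm_frame[of z \<theta>] assms(1) by simp
  then have "(norm z)\<^sup>2 * (cos \<beta>)\<^sup>2 \<le> (r\<^sup>2 + (r * tan \<beta>)\<^sup>2) * (cos \<beta>)\<^sup>2"
    by (intro mult_right_mono) auto
  also have "\<dots> = r\<^sup>2 * (cos \<beta>)\<^sup>2 + r\<^sup>2 * (cos \<beta> * tan \<beta>)\<^sup>2"
    by (simp add: power_mult_distrib algebra_simps)
  also have "\<dots> = r\<^sup>2" unfolding trig(3) by (simp flip: distrib_left)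
  finally have "(norm z * cos \<beta>)\<^sup>2 \<le> r\<^sup>2" by (simp add: power_mult_distrib)
  then show ?thesis using assms(3) by (rule power2_le_imp_le)
qed

lemma mem_stick:
  "z \<in> stick i j \<longleftrightarrow> z \<bullet> dir (normal i (int j)) = radius i \<and>
     \<bar>z \<bullet> perp (normal i (int j))\<bar> \<le> 7 / 8 * (radius i * tan \<beta>)"
proof -
  define \<theta> where "\<theta> = normal i (int j)"
  define \<tau> where "\<tau> = 7 / 8 * (radius i * tan \<beta>)"
  have \<tau>: "\<tau> > 0" using trig(4) radius(1)[of i] by (simp add: \<tau>_def)
  have "z \<in> stick i j \<longleftrightarrow> (\<exists>u. 0 \<le> u \<and> u \<le> 1 \<and> z = radius i *\<^sub>R dir \<theta> + (2 * u * \<tau> - \<tau>) *\<^sub>R perp \<theta>)"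
    unfolding stick_def Let_def in_segment \<theta>_def[symmetric] \<tau>_def[symmetric]
    by (simp add: algebra_simps pt_eq_iff)
  also have "\<dots> \<longleftrightarrow> (\<exists>q. \<bar>q\<bar> \<le> \<tau> \<and> z = radius i *\<^sub>R dir \<theta> + q *\<^sub>R perp \<theta>)"
  proof safe
    fix u :: real assume "0 \<le> u" "u \<le> 1"
    then have "0 \<le> u * \<tau>" "u * \<tau> \<le> \<tau>" using \<tau> by auto
    then show "\<exists>q. \<bar>q\<bar> \<le> \<tau> \<and> radius i *\<^sub>R dir \<theta> + (2 * u * \<tau> - \<tau>) *\<^sub>R perp \<theta> = radius i *\<^sub>R dir \<theta> + q *\<^sub>R perp \<theta>"
      by (intro exI[of _ "2 * u * \<tau> - \<tau>"]) auto
  next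
    fix q assume "\<bar>q\<bar> \<le> \<tau>"
    then show "\<exists>u. 0 \<le> u \<and> u \<le> 1 \<and> radius i *\<^sub>R dir \<theta> + q *\<^sub>R perp \<theta> = radius i *\<^sub>R dir \<theta> + (2 * u * \<tau> - \<tau>) *\<^sub>R perp \<theta>"
      using \<tau> by (intro exI[of _ "(q + \<tau>) / (2 * \<tau>)"]) (auto simp: field_simps)
  qed
  also have "\<dots> \<longleftrightarrow> z \<bullet> dir \<theta> = radius i \<and> \<bar>z \<bullet> perp \<theta>\<bar> \<le> \<tau>"
    using frame_expansion[of z \<theta>]
    by (auto simp: inner_add_left dir_inner inner_commute[of "perp \<theta>" "dir \<theta>"])
  finally show ?thesis by (simp add: \<theta>_def \<tau>_def)
qed

lemma norm_stick:
  assumes "z \<in> stick i j"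
  shows "radius i \<le> norm z" "norm z * cos \<beta> \<le> radius i"
proof -
  let ?\<theta> = "normal i (int j)"
  have z: "z \<bullet> dir ?\<theta> = radius i" "\<bar>z \<bullet> perp ?\<theta>\<bar> \<le> 7 / 8 * (radius i * tan \<beta>)"
    using assms by (auto simp: mem_stick)
  have "0 \<le> radius i * tan \<beta>" using trig(4) radius(1)[of i] by simp
  then have "\<bar>z \<bullet> perp ?\<theta>\<bar> \<le> radius i * tan \<beta>" using z(2) by linarith
  then show "norm z * cos \<beta> \<le> radius i" using norm_edge_le[OF z(1)] radius(1)[of i] by simp
  show "radius i \<le> norm z" using norm_cauchy_schwarz[of z "dir ?\<theta>"] z(1) by simp
qed

text \<open>The lines of two edges with normals \<open>2 * \<psi>\<close> apart meet at tangential
  coordinate \<open>r * tan \<psi>\<close>. Since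
  \<open>\<beta> \<le> \<psi> \<le> pi - \<beta>\<close>, its size is at least
  \<open>r * tan \<beta>\<close>, beyond the 7/8 covered by a stick. Products replace tangents
  because \<open>cos \<psi>\<close> may vanish.\<close>

lemma stick_disjoint_ring:
  assumes "j < j'" "j' < k"
  shows "stick i j \<inter> stick i j' = {}"
proof (rule ccontr)
  assume "\<not> ?thesis"
  then obtain z where z: "z \<in> stick i j" "z \<in> stick i j'" by blast
  define q where "q = z \<bullet> perp (normal i (int j))"
  define \<psi> where "\<psi> = real (j' - j) * \<beta>"
  let ?r = "radius i"
  have "normal i (int j') - normal i (int j) = 2 * \<psi>"
    using assms(1) by (simp add: normal_def \<psi>_def of_nat_diff algebra_simps)
  then have "?r = ?r * cos (2 * \<psi>) + q * sin (2 * \<psi>)"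
    using inner_dir_frame[of z "normal i (int j')" "normal i (int j)"] z by (simp add: mem_stick q_def)
  then have "q * sin (2 * \<psi>) = ?r * (1 - cos (2 * \<psi>))" by (simp add: right_diff_distrib)
  moreover have "1 - cos (2 * \<psi>) = 2 * (sin \<psi> * sin \<psi>)" by (simp add: cos_double_sin power2_eq_square)
  ultimately have eq: "sin \<psi> * (q * cos \<psi>) = sin \<psi> * (?r * sin \<psi>)"
    unfolding sin_double by simp
  have "1 * \<beta> \<le> \<psi>" unfolding \<psi>_def using assms \<beta>(1) by (intro mult_right_mono) auto
  moreover have "\<psi> \<le> real (k - 1) * \<beta>" unfolding \<psi>_def using assms \<beta>(1) by (intro mult_right_mono) auto
  moreover have "real (k - 1) * \<beta> = pi - \<beta>" using \<beta>(4) k by (simp add: of_nat_diff algebra_simps)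
  ultimately have \<psi>: "\<beta> \<le> \<psi>" "\<psi> + \<beta> \<le> pi" by auto
  have sp: "sin \<psi> > 0" using \<psi> \<beta>(1) by (intro sin_gt_zero) auto
  with eq have eq': "q * cos \<psi> = ?r * sin \<psi>" by simp
  have "0 \<le> sin (\<psi> - \<beta>)" "0 \<le> sin (\<psi> + \<beta>)" using \<psi> \<beta> by (intro sin_ge_zero; simp)+
  then have le: "sin \<beta> * \<bar>cos \<psi>\<bar> \<le> sin \<psi> * cos \<beta>"
    by (auto simp: sin_diff sin_add abs_if algebra_simps)
  have "?r * (sin \<psi> * cos \<beta>) = \<bar>q\<bar> * \<bar>cos \<psi>\<bar> * cos \<beta>"
    using eq' sp trig(2) radius(1)[of i] by (metis abs_mult abs_of_nonneg le_less less_le_trans mult.assoc zero_le_mult_iff zero_less_one)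
  also have "\<dots> \<le> 7 / 8 * (?r * tan \<beta>) * \<bar>cos \<psi>\<bar> * cos \<beta>"
    using z(1) trig(2) by (intro mult_right_mono) (auto simp: mem_stick q_def)
  also have "\<dots> = 7 / 8 * ?r * (sin \<beta> * \<bar>cos \<psi>\<bar>)" unfolding trig(3)[symmetric] by simp
  also have "\<dots> \<le> 7 / 8 * ?r * (sin \<psi> * cos \<beta>)"
    using le radius(1)[of i] by (intro mult_left_mono) auto
  finally have "?r * (sin \<psi> * cos \<beta>) \<le> 7 / 8 * (?r * (sin \<psi> * cos \<beta>))" by (simp only: mult.assoc)
  moreover have "?r * (sin \<psi> * cos \<beta>) > 0" using sp trig(2) radius(1)[of i] by (intro mult_pos_pos) auto
  ultimately show False by linarith
qed

text \<open>Sticks of different rings lie in the annuli between incircle and circumcircle, which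
  \<open>rings_nested\<close> separates.\<close>

lemma stick_disjoint:
  assumes "i < n" "i' < n" "j < k" "j' < k" "(i, j) \<noteq> (i', j')"
  shows "stick i j \<inter> stick i' j' = {}"
proof -
  have *: "stick i j \<inter> stick i' j' = {}" if "i < i'" "i' < n" for i i' j j'
  proof -
    have False if z: "z \<in> stick i j" "z \<in> stick i' j'" for z
    proof -
      have "radius (Suc i) * cos \<beta> \<le> norm z * cos \<beta>"
        using norm_stick(1)[OF z(2)] radius(4)[of "Suc i" i'] \<open>i < i'\<close> trig(2) by (intro mult_right_mono) auto
      then show False using norm_stick(2)[OF z(1)] rings_nested[of i] \<open>i < i'\<close> \<open>i' < n\<close> by simp
    qed
    then show ?thesis by blast
  qed
  consider "i < i'" | "i' < i" | "i = i'" "j < j'" | "i = i'" "j' < j" using assms(5) by force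
  then show ?thesis
    using *[of i i' j j'] *[of i' i j' j] stick_disjoint_ring[of j j' i] stick_disjoint_ring[of j' j i] assms
    by cases auto
qed

text \<open>A point on an edge but off its stick lies in the last eighth of a half-edge. The sign
  \<open>e\<close> selects the end; its vertex direction is the normal turned by
  \<open>\<beta>\<close>, so \<open>m\<close> has parity opposite to \<open>i\<close>.\<close>

lemma gap_near_vertex:
  assumes "gauge i z = radius i" "\<And>j. j < k \<Longrightarrow> z \<notin> stick i j"
  shows "\<exists>m. odd (m + int i) \<and> dist z ((radius i / cos \<beta>) *\<^sub>R dir (of_int m * \<beta>)) \<le> radius i * tan \<beta> / 8"
proof -
  obtain j where j: "j < k" "z \<bullet> dir (normal i (int j)) = radius i"
    "\<bar>z \<bullet> perp (normal i (int j))\<bar> \<le> radius i * tan \<beta>"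
    using edge[OF assms(1)] by blast
  let ?\<theta> = "normal i (int j)" and ?r = "radius i"
  define q where "q = z \<bullet> perp ?\<theta>"
  define e :: int where "e = (if q \<ge> 0 then 1 else -1)"
  define m where "m = 2 * int j + int (i mod 2) + e"
  have q: "\<bar>q\<bar> > 7 / 8 * (?r * tan \<beta>)" using assms(2)[OF j(1)] j(2) by (auto simp: mem_stick q_def)
  have qe: "q = of_int e * \<bar>q\<bar>" by (simp add: e_def)
  have m\<beta>: "of_int m * \<beta> = ?\<theta> + of_int e * \<beta>" by (simp add: m_def normal_def algebra_simps)
  have d: "dir (of_int m * \<beta>) = cos \<beta> *\<^sub>R dir ?\<theta> + (of_int e * sin \<beta>) *\<^sub>R perp ?\<theta>"
    unfolding m\<beta> by (simp add: e_def pt_eq_iff cos_add sin_add cos_diff sin_diff)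
  have v: "(?r / cos \<beta>) *\<^sub>R dir (of_int m * \<beta>) = ?r *\<^sub>R dir ?\<theta> + (of_int e * (?r * tan \<beta>)) *\<^sub>R perp ?\<theta>"
    unfolding d using trig(2) by (simp add: scaleR_add_right tan_def)
  have "z - (?r / cos \<beta>) *\<^sub>R dir (of_int m * \<beta>) = (of_int e * (\<bar>q\<bar> - ?r * tan \<beta>)) *\<^sub>R perp ?\<theta>"
    unfolding v by (subst frame_expansion[of z ?\<theta>], unfold j(2) q_def[symmetric], subst qe) (simp add: algebra_simps)
  then have "dist z ((?r / cos \<beta>) *\<^sub>R dir (of_int m * \<beta>)) = \<bar>of_int e * (\<bar>q\<bar> - ?r * tan \<beta>)\<bar>"
    by (simp add: dist_norm)
  also have "\<dots> = ?r * tan \<beta> - \<bar>q\<bar>" using j(3) by (auto simp: e_def q_def)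
  also have "\<dots> \<le> ?r * tan \<beta> / 8" using q by simp
  finally have "dist z ((?r / cos \<beta>) *\<^sub>R dir (of_int m * \<beta>)) \<le> ?r * tan \<beta> / 8" .
  moreover have "odd (m + int i)" unfolding m_def e_def by (simp add: zmod_int)
  ultimately show ?thesis by blast
qed

text \<open>Law of cosines: the directions enclose an angle of at least \<open>\<beta>\<close>, and
  \<open>R * R' \<ge> R * R\<close> reduces the bound to a chord of the smaller circle.\<close>

lemma vertex_dist:
  assumes "odd (m - m')" "0 < R" "R \<le> R'"
  shows "2 * R * sin (\<beta> / 2) \<le> dist (R *\<^sub>R dir (of_int m * \<beta>)) (R' *\<^sub>R dir (of_int m' * \<beta>))"
proof (rule power2_le_imp_le)
  let ?a = "dir (of_int m * \<beta>)" and ?b = "dir (of_int m' * \<beta>)"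
  have "?a \<bullet> ?b = cos (of_int (m' - m) * \<beta>)" by (simp add: dir_inner algebra_simps)
  also have "\<dots> \<le> cos \<beta>"
    using cos_odd_multiple_le[of "m' - m" k] assms(1) k by (simp add: \<beta>_def)
  finally have c: "?a \<bullet> ?b \<le> cos \<beta>" .
  have "(2 * R * sin (\<beta> / 2))\<^sup>2 = 2 * R * R * (1 - cos \<beta>)"
    using cos_double_sin[of "\<beta> / 2"] by (simp add: power2_eq_square)
  also have "\<dots> \<le> 2 * R * R' * (1 - cos \<beta>)" using assms by (intro mult_right_mono mult_left_mono) auto
  also have "\<dots> \<le> (R - R')\<^sup>2 + 2 * R * R' * (1 - ?a \<bullet> ?b)"
    using c assms by (intro add_increasing mult_left_mono) auto
  also have "\<dots> = (dist (R *\<^sub>R ?a) (R' *\<^sub>R ?b))\<^sup>2"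
  proof -
    have "?a \<bullet> ?a = 1" "?b \<bullet> ?b = 1" by (simp_all add: dir_inner)
    then show ?thesis
      unfolding dist_norm power2_norm_eq_inner
      by (simp add: inner_diff_left inner_diff_right inner_commute[of ?b ?a] power2_eq_square algebra_simps)
  qed
  finally show "(2 * R * sin (\<beta> / 2))\<^sup>2 \<le> (dist (R *\<^sub>R ?a) (R' *\<^sub>R ?b))\<^sup>2" .
qed simp

text \<open>The cubic Taylor bound gives \<open>sin x \<ge> x / 2\<close> on (0, 1), and
  \<open>\<beta> / 4 = pi / (4 * k)\<close> with \<open>pi > 3\<close>.\<close>

lemma sin_half_ge: "3 / (4 * k) \<le> sin (\<beta> / 2)"
proof -
  define x where "x = \<beta> / 2"
  have x: "0 < x" "x < 1" using \<beta> by (auto simp: x_def)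
  have "\<bar>sin x - x\<bar> \<le> inverse (fact 3) * \<bar>x\<bar> ^ 3"
    using Maclaurin_sin_bound[of x 3] by (simp add: numeral_3_eq_3 sin_coeff_def)
  moreover have "x ^ 3 \<le> x" using x by (simp add: power3_eq_cube mult_le_one mult_left_le_one_le)
  ultimately have "x / 2 \<le> sin x" using x by (simp add: fact_numeral abs_if split: if_splits)
  moreover have "3 / (4 * k) \<le> x / 2"
    using pi_gt3 k by (simp add: x_def \<beta>_def field_simps)
  ultimately show ?thesis by (simp add: x_def)
qed

text \<open>With \<open>s = sin (\<beta> / 2)\<close>, the vertices are at least
  \<open>2 * R * s\<close> apart. As \<open>R' \<le> 2 * R\<close>, the two gaps cost at most
  \<open>(3 * R) * (2 * s) / 8\<close>, which leaves \<open>5 / 4 * (R * s)\<close>.\<close>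

lemma gap_dist:
  assumes "Suc i < n"
    and z: "gauge i z = radius i" "\<And>j. j < k \<Longrightarrow> z \<notin> stick i j"
    and w: "gauge (Suc i) w = radius (Suc i)" "\<And>j. j < k \<Longrightarrow> w \<notin> stick (Suc i) j"
  shows "3 / (4 * k) \<le> dist z w"
proof -
  obtain m m' where m: "odd (m + int i)" "odd (m' + int (Suc i))"
    "dist z ((radius i / cos \<beta>) *\<^sub>R dir (of_int m * \<beta>)) \<le> radius i * tan \<beta> / 8"
    "dist w ((radius (Suc i) / cos \<beta>) *\<^sub>R dir (of_int m' * \<beta>)) \<le> radius (Suc i) * tan \<beta> / 8"
    using gap_near_vertex[OF z] gap_near_vertex[OF w] by blast
  define R where "R = radius i / cos \<beta>"
  define R' where "R' = radius (Suc i) / cos \<beta>"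
  have "radius (Suc i) \<le> 2 * radius i" using radius(5)[of "Suc i"] radius(1)[of i] assms(1) by simp
  then have R: "1 \<le> R" "R \<le> R'" "R' \<le> 2 * R"
    using trig(2) cos_le_one[of \<beta>] radius(1)[of i] radius(4)[of i "Suc i"]
    by (auto simp: R_def R'_def field_simps simp del: cos_le_one)
  have rt: "radius i * tan \<beta> = R * sin \<beta>" "radius (Suc i) * tan \<beta> = R' * sin \<beta>"
    by (auto simp: R_def R'_def tan_def)
  define s where "s = sin (\<beta> / 2)"
  have s: "3 / (4 * k) \<le> s" using sin_half_ge by (simp add: s_def)
  then have s0: "0 \<le> s" using k by (meson divide_nonneg_nonneg mult_nonneg_nonneg of_nat_0_le_iff order_trans zero_le_numeral)
  have "sin \<beta> = 2 * s * cos (\<beta> / 2)" using sin_double[of "\<beta> / 2"] by (simp add: s_def)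
  also have "\<dots> \<le> 2 * s * 1" using s0 by (intro mult_left_mono) auto
  finally have sb: "sin \<beta> \<le> 2 * s" by simp
  have "odd (m - m')" using m(1,2) by presburger
  then have "2 * R * s \<le> dist (R *\<^sub>R dir (of_int m * \<beta>)) (R' *\<^sub>R dir (of_int m' * \<beta>))"
    unfolding s_def using R by (intro vertex_dist) auto
  also have "\<dots> \<le> R * sin \<beta> / 8 + dist z w + R' * sin \<beta> / 8"
    using m(3,4) dist_triangle[of "R *\<^sub>R dir (of_int m * \<beta>)" "R' *\<^sub>R dir (of_int m' * \<beta>)" z]
      dist_triangle[of z "R' *\<^sub>R dir (of_int m' * \<beta>)" w]
    unfolding rt R_def[symmetric] R'_def[symmetric] by (simp add: dist_commute)
  also have "\<dots> = (R + R') * sin \<beta> / 8 + dist z w" by (simp add: field_simps)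
  also have "(R + R') * sin \<beta> \<le> (3 * R) * (2 * s)"
    using R sb trig(1) s0 by (intro mult_mono) auto
  finally have "5 / 4 * (R * s) \<le> dist z w" by simp
  moreover have "1 * s \<le> R * s" using R s0 by (intro mult_right_mono) auto
  ultimately show ?thesis using s s0 by linarith
qed

text \<open>A point of polygon \<open>i\<close> is inside polygon \<open>Suc i\<close> and
  \<open>t\<close> is outside, so the path crosses the latter in a gap at least
  \<open>3 / (4 * k)\<close> away. Repeating this gives one such piece for each of the remaining
  \<open>n - 1 - i\<close> rings.\<close>

lemma long_path_aux:
  assumes "polygonal_path_in P z t ps" "z \<in> P" "norm t \<ge> 4" "t $ 1 = norm t" "t $ 2 = 0"
    and avoid: "\<And>i j. i < n \<Longrightarrow> j < k \<Longrightarrow> stick i j \<inter> P = {}"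
    and "i < n" "gauge i z = radius i"
  shows "(real n - 1 - i) * (3 / (4 * k)) \<le> path_len ps"
  using assms(1,2,7,8)
proof (induction "n - i" arbitrary: i z ps)
  case 0
  then show ?case by simp
next
  case (Suc l)
  show ?case
  proof (cases "Suc i < n")
    case False
    then have "real n - 1 - i = 0" using Suc by auto
    then show ?thesis using path_len_nonneg by simp
  next
    case True
    have z: "z \<notin> stick i j" if "j < k" for j using avoid[of i j] that Suc by blast
    have "norm z * cos \<beta> \<le> radius i"
    proof -
      obtain j where "z \<bullet> dir (normal i (int j)) = radius i"
        "\<bar>z \<bullet> perp (normal i (int j))\<bar> \<le> radius i * tan \<beta>"
        using edge[OF Suc.prems(4)] by blast
      then show ?thesis using radius(1)[of i] by (intro norm_edge_le) auto
    qed
    then have "norm z * cos \<beta> \<le> radius (Suc i) * cos \<beta>" using rings_nested[of i] Suc by simp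
    then have "norm z \<le> radius (Suc i)" using trig(2) by simp
    then have z': "gauge (Suc i) z \<le> radius (Suc i)" using gauge_le_norm[of "Suc i" z] by simp
    \<comment> \<open>The normal with index 0 has angle 0 or \<open>\<beta>\<close>, hence cosine at
      least 1/2, and \<open>t\<close> at distance at least 4 on the positive axis has gauge at least
      2.\<close>
    have t: "radius (Suc i) \<le> gauge (Suc i) t"
    proof -
      have "cos (normal (Suc i) 0) \<ge> 1 / 2"
        using trig(2) by (cases "even i") (auto simp: normal_def mod_Suc even_iff_mod_2_eq_zero odd_iff_mod_2_eq_one)
      then have "4 * (1 / 2) \<le> norm t * cos (normal (Suc i) 0)" using assms(3) by (intro mult_mono) auto
      also have "\<dots> = t \<bullet> dir (normal (Suc i) 0)" using assms(4,5) by (simp add: inner_pt)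
      also have "\<dots> \<le> gauge (Suc i) t" by (rule inner_normal_le_gauge)
      finally show ?thesis using radius(3)[OF True] by simp
    qed
    from polygonal_path_crossing[OF Suc.prems(1,2) continuous_on_gauge z' t] obtain w qs where
      w: "w \<in> P" "gauge (Suc i) w = radius (Suc i)" "polygonal_path_in P w t qs"
        "dist z w + path_len qs \<le> path_len ps" by blast
    have w': "w \<notin> stick (Suc i) j" if "j < k" for j using avoid[of "Suc i" j] that True w(1) by blast
    have "(real n - 1 - Suc i) * (3 / (4 * k)) \<le> path_len qs"
      using Suc.hyps(1)[of "Suc i" w qs] Suc.hyps(2) w True by simp
    moreover have "3 / (4 * k) \<le> dist z w"
      by (rule gap_dist[OF True Suc.prems(4) z w(2) w'])
    ultimately have "(real n - 1 - Suc i) * (3 / (4 * k)) + 3 / (4 * k) \<le> path_len ps" using w(4) by linarith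
    moreover have "(real n - 1 - i) * x = (real n - 1 - Suc i) * x + x" for x
      by (simp add: algebra_simps)
    ultimately show ?thesis by (simp only:)
  qed
qed

lemma long_path:
  assumes "polygonal_path_in P 0 t ps" "0 \<in> P" "norm t \<ge> 4" "t $ 1 = norm t" "t $ 2 = 0"
    and avoid: "\<And>i j. i < n \<Longrightarrow> j < k \<Longrightarrow> stick i j \<inter> P = {}"
  shows "(real n - 1) * (3 / (4 * k)) \<le> path_len ps"
proof -
  have "gauge 0 0 \<le> radius 0" using gauge_le_norm[of 0 0] radius(1)[of 0] by simp
  moreover have "radius 0 \<le> gauge 0 t"
    using inner_normal_le_gauge[of t 0 0] assms(3-5) by (simp add: normal_def inner_pt radius_def)
  ultimately obtain w qs where
      w: "w \<in> P" "gauge 0 w = radius 0" "polygonal_path_in P w t qs" "dist 0 w + path_len qs \<le> path_len ps"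
    using polygonal_path_crossing[OF assms(1,2) continuous_on_gauge] by blast
  have "(real n - 1 - 0) * (3 / (4 * k)) \<le> path_len qs"
    using long_path_aux[OF w(3,1) assms(3-5) avoid, of 0] n w(2) by simp
  moreover have "path_len qs \<le> path_len ps" using w(4) zero_le_dist[of 0 w] by linarith
  ultimately show ?thesis by simp
qed

end

section \<open>The lower bound\<close>

text \<open>Degenerate segments far from the rings, used to bring the number of holes to exactly \<open>h\<close>.\<close>
definition filler :: "nat \<Rightarrow> nat \<Rightarrow> pt" where
  "filler h i = vector [-4, i / h]"

lemma filler_in_box:
  assumes "i \<in> {1..h}"
  shows "filler h i \<in> box (vector [-5, -5]) (vector [5, 5])"
proof -
  have "0 \<le> real i / h" "real i / h \<le> 1" using assms by auto
  then have "- 5 < real i / h" "real i / h < 5" by linarith+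
  then show ?thesis by (simp add: filler_def mem_box_pt)
qed

lemma filler_norm: "4 \<le> norm (filler h i)"
  using component_le_norm_cart[of "filler h i" 1] by (simp add: filler_def)

lemma filler_inj: "h \<ge> 1 \<Longrightarrow> i \<noteq> j \<Longrightarrow> filler h i \<noteq> filler h j"
  by (auto simp: filler_def pt_eq_iff)

definition target :: pt where "target = vector [4, 0]"

lemma target: "target $ 1 = 4" "target $ 2 = 0" "norm target = 4"
  "target \<in> box (vector [-5, -5]) (vector [5, 5])"
proof -
  show t: "target $ 1 = 4" "target $ 2 = 0" by (simp_all add: target_def)
  then show "norm target = 4" by (simp add: norm_eq_sqrt_inner inner_pt)
  show "target \<in> box (vector [-5, -5]) (vector [5, 5])" using t by (simp add: mem_box_pt)
qed

lemma filler_ne: "filler h i \<noteq> 0" "filler h i \<noteq> target"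
  by (simp_all add: pt_eq_iff filler_def target_def)

lemma zero_in_box: "0 \<in> box (vector [-5, -5]) (vector [5, 5] :: pt)"
  by (simp add: mem_box_pt)

text \<open>This serves the case \<open>h < 400\<close>, too small for the ring construction: the
  plain distance 4 between 0 and \<open>target\<close> suffices.\<close>

lemma g_ge_const:
  assumes "h \<ge> 1"
  shows "ereal (4 / 20) \<le> g h"
proof (rule g_lower_from_segments[where S = "\<lambda>i. {filler h i}" and s = 0 and t = target])
  show "\<exists>a b. {filler h i} = closed_segment a b" for i
    by (rule exI[of _ "filler h i"], rule exI[of _ "filler h i"]) simp
  show "{filler h i} \<subseteq> box (vector [-5, -5]) (vector [5, 5]) - {0, target}" if "i \<in> {1..h}" for i
    using filler_in_box[OF that] filler_ne by auto
  show "4 \<le> path_len ps" if "polygonal_path_in P 0 target ps" for P ps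
    using dist_le_path_len[OF that] target(3) by simp
qed (use assms filler_inj target(4) zero_in_box in auto)

lemma g_ge_rings:
  fixes m h :: nat
  assumes m: "m \<ge> 1" and h: "400 * m ^ 3 \<le> h"
  shows "ereal (m / 2 / 20) \<le> g h"
proof -
  \<comment> \<open>This makes \<open>20 * n = k\<^sup>2\<close> and
    \<open>n * k = 400 * m ^ 3\<close>, the number of sticks, while
    \<open>n / k = m\<close>.\<close>
  define n where "n = 20 * m\<^sup>2"
  define k where "k = 20 * m"
  interpret rings n k
    using m by unfold_locales (auto simp: n_def k_def power2_eq_square)
  have k0: "k > 0" using k by simp
  have nkh: "n * k \<le> h"
    using h by (simp add: n_def k_def power2_eq_square power3_eq_cube mult_ac)
  have "0 < n * k" using n k by simp
  then have h1: "h \<ge> 1" using nkh by linarith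
  \<comment> \<open>Hole indices start at 1, hence the shift by one before splitting into ring and
    edge number.\<close>
  define S where "S i = (if i \<le> n * k then stick ((i - 1) div k) ((i - 1) mod k) else {filler h i})" for i
  have idx: "(i - 1) div k < n" "(i - 1) mod k < k" if "i \<in> {1..h}" "i \<le> n * k" for i
    using that k0 by (auto simp: less_mult_imp_div_less)
  have stick_norm: "1 \<le> norm z" "norm z < 2" if "z \<in> stick i j" "i < n" for z i j
  proof -
    show "1 \<le> norm z" using norm_stick(1)[OF that(1)] radius(1)[of i] by simp
    have "norm z * cos \<beta> < radius (Suc i) * cos \<beta>"
      using norm_stick(2)[OF that(1)] rings_nested[OF that(2)] by simp
    then have "norm z < radius (Suc i)" using trig(2) by simp
    then show "norm z < 2" using radius(5)[of "Suc i"] that(2) by simp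
  qed
  show ?thesis
  proof (rule g_lower_from_segments[where S = S and s = 0 and t = target])
    show "\<exists>a b. S i = closed_segment a b" if "i \<in> {1..h}" for i
    proof (cases "i \<le> n * k")
      case True
      then show ?thesis unfolding S_def stick_def Let_def by (simp, blast)
    next
      case False
      then show ?thesis by (intro exI[of _ "filler h i"]) (simp add: S_def)
    qed
    show "S i \<inter> S j = {}" if ij: "i \<in> {1..h}" "j \<in> {1..h}" "i \<noteq> j" for i j
    proof -
      have mixed: "S i \<inter> S j = {}" if "i \<in> {1..h}" "i \<le> n * k" "\<not> j \<le> n * k" for i j
      proof -
        have "filler h j \<notin> S i"
          using stick_norm(2)[of "filler h j" "(i - 1) div k"] idx[OF that(1,2)] filler_norm[of h j] that(2)
          by (auto simp: S_def)
        then show ?thesis using that(3) by (simp add: S_def)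
      qed
      consider "i \<le> n * k" "j \<le> n * k" | "i \<le> n * k" "\<not> j \<le> n * k" | "\<not> i \<le> n * k" "j \<le> n * k"
        | "\<not> i \<le> n * k" "\<not> j \<le> n * k" by blast
      then show ?thesis
      proof cases
        case 1
        have "((i - 1) div k, (i - 1) mod k) \<noteq> ((j - 1) div k, (j - 1) mod k)"
        proof
          assume "((i - 1) div k, (i - 1) mod k) = ((j - 1) div k, (j - 1) mod k)"
          then have "i - 1 = j - 1" by (metis div_mult_mod_eq prod.inject)
          then show False using ij by auto
        qed
        then show ?thesis using stick_disjoint idx[OF ij(1)] idx[OF ij(2)] 1 by (simp add: S_def)
      next
        case 2 then show ?thesis using mixed[of i j] ij by blast
      next
        case 3 then show ?thesis using mixed[of j i] ij by blast
      next
        case 4 then show ?thesis using filler_inj[OF h1 ij(3)] by (simp add: S_def)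
      qed
    qed
    show "S i \<subseteq> box (vector [-5, -5]) (vector [5, 5]) - {0, target}" if i: "i \<in> {1..h}" for i
    proof
      fix z assume z: "z \<in> S i"
      show "z \<in> box (vector [-5, -5]) (vector [5, 5]) - {0, target}"
      proof (cases "i \<le> n * k")
        case True
        then have zn: "1 \<le> norm z" "norm z < 2"
          using stick_norm[of z "(i - 1) div k"] z idx[OF i True] by (auto simp: S_def)
        then have "\<bar>z $ 1\<bar> < 2" "\<bar>z $ 2\<bar> < 2"
          using component_le_norm_cart[of z 1] component_le_norm_cart[of z 2] by linarith+
        then show ?thesis using zn target(3) by (auto simp: mem_box_pt)
      next
        case False
        then show ?thesis using z filler_in_box[OF i] filler_ne by (simp add: S_def)
      qed
    qed
    show "m / 2 \<le> path_len ps"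
      if ps: "polygonal_path_in P 0 target ps" "0 \<in> P" and avoid: "\<And>i. i \<in> {1..h} \<Longrightarrow> S i \<inter> P = {}" for P ps
    proof -
      have "stick i j \<inter> P = {}" if ij: "i < n" "j < k" for i j
      proof -
        have "i * k + j < i * k + k" using ij by simp
        also have "\<dots> = Suc i * k" by simp
        also have "\<dots> \<le> n * k" using ij by (intro mult_right_mono) auto
        finally have "i * k + j < n * k" .
        then have "S (i * k + j + 1) = stick i j" "i * k + j + 1 \<in> {1..h}"
          using ij nkh by (auto simp: S_def)
        then show ?thesis using avoid by metis
      qed
      then have "(real n - 1) * (3 / (4 * k)) \<le> path_len ps"
        using target by (intro long_path[OF ps]) auto
      moreover have "real m / 2 \<le> (real n - 1) * (3 / (4 * k))"
      proof -
        have "1 \<le> real m * real m" using m by (metis mult_le_mono of_nat_1 of_nat_le_iff of_nat_mult mult_1)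
        then show ?thesis using m by (simp add: n_def k_def field_simps power2_eq_square)
      qed
      ultimately show ?thesis by (rule order_trans[rotated])
    qed
  qed (use h1 target(4) zero_in_box in auto)
qed

lemma g_lower:
  assumes h: "h \<ge> 1"
  shows "ereal (1 / 640 * real h powr (1 / 3)) \<le> g h"
proof -
  \<comment> \<open>The predecessor \<open>m\<close> of \<open>j\<close> is the largest number with
    \<open>400 * m ^ 3 \<le> h\<close>.\<close>
  define j where "j = (LEAST j. h < 400 * j ^ 3)"
  have "h < 400 * Suc h ^ 3" by (simp add: power3_eq_cube)
  then have j: "h < 400 * j ^ 3" unfolding j_def by (rule LeastI)
  then obtain m where jm: "j = Suc m" by (cases j) auto
  have m: "400 * m ^ 3 \<le> h"
    using not_less_Least[of m "\<lambda>j. h < 400 * j ^ 3"] jm by (simp add: j_def not_less)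
  \<comment> \<open>The factor 8 comes from \<open>400 \<le> 8 ^ 3\<close>. Then
    \<open>x / 640 = (m + 1) / 80\<close>, which is at most 1/5 for \<open>m = 0\<close> and at most
    \<open>m / 40\<close> otherwise.\<close>
  define x where "x = 8 * (real m + 1)"
  have x: "x > 0" by (simp add: x_def)
  have "real h \<le> x ^ 3"
  proof -
    have "real h < real (400 * Suc m ^ 3)" using j jm by (simp only: of_nat_less_iff)
    also have "\<dots> = 400 * (real m + 1) ^ 3" by (simp add: add.commute)
    also have "\<dots> \<le> 512 * (real m + 1) ^ 3" by (intro mult_right_mono) auto
    finally show ?thesis unfolding x_def power_mult_distrib by simp
  qed
  also have "x ^ 3 = x powr 3" using powr_realpow[OF x, of 3] by simp
  finally have "real h powr (1 / 3) \<le> (x powr 3) powr (1 / 3)"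
    by (intro powr_mono2) auto
  also have "\<dots> = x" unfolding powr_powr using x by simp
  finally have le: "1 / 640 * real h powr (1 / 3) \<le> (real m + 1) / 80" by (simp add: x_def)
  show ?thesis
  proof (cases "m = 0")
    case True
    then have "ereal (1 / 640 * real h powr (1 / 3)) \<le> ereal (4 / 20)" using le by simp
    then show ?thesis using g_ge_const[OF h] by (rule order_trans)
  next
    case False
    then have "ereal (1 / 640 * real h powr (1 / 3)) \<le> ereal (m / 2 / 20)" using le by simp
    also have "\<dots> \<le> g h" using False m by (intro g_ge_rings) auto
    finally show ?thesis .
  qed
qed

theorem theorem1:
  "\<exists>c1 c2 :: real. c1 > 0 \<and> c2 > 0 \<and>
     (\<forall>h::nat. h \<ge> 1 \<longrightarrow>
        ereal (c1 * real h powr (1/3)) \<le> g h \<and> g h \<le> ereal (c2 * sqrt (real h)))"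
  using g_lower g_upper by (intro exI[of _ "1 / 640"] exI[of _ 34]) auto

end
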